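(* Let $H\in(0,1)$ and let $Z=(Z_t,\,t\ge0)$ be a one-dimensional centered Gaussian process that is self-similar with index $H$. Put $r(t)=e^{-Ht}\,\mathbb{E}[Z_1Z_{e^t}]$ for $t\in\mathbb{R}$. Suppose that $r$ is a non-negative decreasing function on $[0,\infty)$, that $r\in L^1(\mathbb{R})$, and that there exists a positive constant $c$ such that $$\int_0^\infty r(t)\cos(t\lambda)\,dt\ge\frac{c}{(|\lambda|+1)^{1+2H}}$$ for all $\lambda\in\mathbb{R}$. Then there exists a positive constant $\kappa_H$ such that for any integer $m\ge1$ and any times $0=s_0<s_1\le\dots\le s_m<t<\infty$, $$\mathrm{Var}\big(Z_t\mid Z_{s_1},\dots,Z_{s_m}\big)\ge\kappa_H\min_{1\le j\le m}|t-s_j|^{2H}.$$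
   Context: Self-similarity with index $H$ means that for every $a>0$ the processes $(Z_{at})_{t\ge0}$ and $(a^HZ_t)_{t\ge0}$ have the same law. The function $r$ is the (even) covariance function $r(t)=\mathbb{E}[Y_0Y_t]$ of the stationary centered Gaussian process $Y_t=e^{-Ht}Z_{e^t}$, $t\in\mathbb{R}$. $\mathrm{Var}(\cdot\mid\cdot)$ denotes conditional variance. *)

theory Defs
  imports "HOL-Probability.Probability"
begin

(* Degenerate Gaussians (variance zero) are included: a process that is self-similar with
   positive index satisfies Z 0 = 0 almost surely, and linear combinations may cancel. *)
definition gaussian_rv :: "'a measure \<Rightarrow> ('a \<Rightarrow> real) \<Rightarrow> bool" where
  "gaussian_rv M X \<longleftrightarrow> X \<in> borel_measurable M \<and>
     ((\<exists>\<mu>. AE \<omega> in M. X \<omega> = \<mu>) \<or>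
      (\<exists>\<mu> \<sigma>. 0 < \<sigma> \<and> distributed M lborel X (normal_density \<mu> \<sigma>)))"

definition centered_gaussian_process ::
    "'a measure \<Rightarrow> 'i set \<Rightarrow> ('i \<Rightarrow> 'a \<Rightarrow> real) \<Rightarrow> bool" where
  "centered_gaussian_process M T Z \<longleftrightarrow>
     (\<forall>I a. finite I \<and> I \<subseteq> T \<longrightarrow> gaussian_rv M (\<lambda>\<omega>. \<Sum>i\<in>I. a i * Z i \<omega>)) \<and>
     (\<forall>i\<in>T. integral\<^sup>L M (Z i) = 0)"

(* The law of the process (X t) for t in T, on the product sigma-algebra of the space of all
   real functions on T. *)
definition process_law ::
    "'a measure \<Rightarrow> 'i set \<Rightarrow> ('i \<Rightarrow> 'a \<Rightarrow> real) \<Rightarrow> ('i \<Rightarrow> real) measure" where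
  "process_law M T X = distr M (\<Pi>\<^sub>M t\<in>T. borel) (\<lambda>\<omega>. \<lambda>t\<in>T. X t \<omega>)"

definition self_similar :: "'a measure \<Rightarrow> real \<Rightarrow> (real \<Rightarrow> 'a \<Rightarrow> real) \<Rightarrow> bool" where
  "self_similar M H Z \<longleftrightarrow>
     (\<forall>a>0. process_law M {0..} (\<lambda>t. Z (a * t)) =
            process_law M {0..} (\<lambda>t \<omega>. a powr H * Z t \<omega>))"

definition generated_by :: "'a measure \<Rightarrow> 'i set \<Rightarrow> ('i \<Rightarrow> 'a \<Rightarrow> real) \<Rightarrow> 'a measure" where
  "generated_by M I X =
     vimage_algebra (space M) (\<lambda>\<omega>. \<lambda>i\<in>I. X i \<omega>) (\<Pi>\<^sub>M i\<in>I. borel)"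

(* A random variable, determined up to almost sure equality like real_cond_exp itself. *)
definition cond_variance :: "'a measure \<Rightarrow> 'a measure \<Rightarrow> ('a \<Rightarrow> real) \<Rightarrow> 'a \<Rightarrow> real" where
  "cond_variance M F X = real_cond_exp M F (\<lambda>\<omega>. (X \<omega> - real_cond_exp M F X \<omega>)\<^sup>2)"

(* The covariance function of the stationary process Y t = exp (- H t) * Z (exp t). *)
definition lamperti_cov :: "'a measure \<Rightarrow> real \<Rightarrow> (real \<Rightarrow> 'a \<Rightarrow> real) \<Rightarrow> real \<Rightarrow> real" where
  "lamperti_cov M H Z t = exp (- H * t) * (\<integral>\<omega>. Z 1 \<omega> * Z (exp t) \<omega> \<partial>M)"

end

theory Submission
  imports Defs
begin

text \<open>
  After the Lamperti change of time \<open>x = ln t\<close> the process becomes stationary with covariance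
  function \<open>r\<close>, and the theorem becomes a quantitative form of local nondeterminism: the value
  of the stationary process at a point cannot be predicted well from points at distance at least
  \<open>\<epsilon>\<close>, the squared error being at least a multiple of \<open>\<epsilon>\<close> to the power \<open>2 H\<close>.

  \<^bold>\<open>From the conditional variance to a quadratic form.\<close> Let \<open>e\<close> be the residual of the orthogonal
  projection of \<open>Z t\<close> onto the span of the observed variables. Joint Gaussianity makes \<open>e\<close>
  independent of the observations, so the conditional variance is almost surely the constant
  \<open>E (e\<^sup>2)\<close> (\<open>cond_variance_gaussian\<close>). All that is needed of this independence is that \<open>e\<close> and
  \<open>e\<^sup>2 - E (e\<^sup>2)\<close> have conditional expectation zero. This is read off from characteristic functions:
  an integrable \<open>V\<close> with \<open>E (V * exp (\<i> \<theta> \<bullet> Y)) = 0\<close> for all \<open>\<theta>\<close> has conditional expectation zero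
  given \<open>Y\<close> (\<open>fourier_zero_imp_cond_exp_zero\<close>), which follows from the one-dimensional uniqueness
  theorem by treating one coordinate of \<open>Y\<close> at a time. By self-similarity \<open>E (e\<^sup>2)\<close> equals a
  quadratic form \<open>\<Sum>j k. b j * b k * r (x j - x k)\<close>, in which \<open>x 0 = ln t\<close> and \<open>b 0\<close> is the power
  \<open>H\<close> of \<open>t\<close>.

  \<^bold>\<open>From the quadratic form to its spectral integral.\<close> Put
  \<open>Q v = \<Sum>j k. b j * b k * r (x j - x k + v)\<close>. It is the covariance of a linear combination of the
  stationary process with its own translate, so it has its maximum at \<open>0\<close>
  (\<open>lamperti_cov_shift_le\<close>). Averaging \<open>Q\<close> against narrow Gaussians therefore gives a lower bound
  for \<open>Q 0\<close>, and Fubini turns these averages into integrals of the Fourier transform of \<open>Q\<close>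
  (\<open>integral_cos_transform_le_value_at_max\<close>). Only this half of Fourier inversion can
  be expected, because \<open>r\<close> may jump at \<open>0\<close>, and it is the half that is wanted. The transform of \<open>Q\<close> at \<open>l\<close> is the
  transform of \<open>r\<close> times \<open>\<bar>\<Sum>j. b j * exp (\<i> * x j * l)\<bar>\<^sup>2\<close>, and the spectral hypothesis bounds the
  first factor below by a multiple of \<open>w l = (1 + \<bar>l\<bar>) powr (- (1 + 2 * H))\<close>.

  \<^bold>\<open>The extremal problem.\<close> It remains to bound the integral of \<open>B\<^sup>2 * w\<close> from below for a
  trigonometric sum \<open>B\<close> with a distinguished frequency \<open>0\<close> and all other frequencies at distance at
  least \<open>\<epsilon>\<close>. The Fejer kernel, dilated by \<open>\<epsilon>\<close>, has as its Fourier transform a tent supported in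
  \<open>[-\<epsilon>, \<epsilon>]\<close>, hence its integral against \<open>B\<close> sees the coefficient at frequency \<open>0\<close> only. The
  Cauchy-Schwarz inequality with weight \<open>w\<close> then gives the bound, the power of \<open>\<epsilon>\<close> coming from
  the dilation (\<open>weighted_energy_lower_bound\<close>).
\<close>

section \<open>Fourier transforms determine conditional expectations\<close>

text \<open>
  A nonnegative weight of total mass \<open>c\<close>, divided by \<open>c\<close>, is the density of a change of measure.
  Under it \<open>Y\<close> has a distribution of its own, and statements about weighted Fourier integrals become
  statements about characteristic functions.
\<close>

lemma (in prob_space) weighted_char:
  fixes W Y :: "'a \<Rightarrow> real"
  assumes W: "integrable M W" "\<And>\<omega>. 0 \<le> W \<omega>" and c: "0 < c" "(\<integral>\<omega>. W \<omega> \<partial>M) = c"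
    and Y[measurable]: "Y \<in> borel_measurable M"
  defines "N \<equiv> distr (density M (\<lambda>\<omega>. ennreal (W \<omega> / c))) borel Y"
  shows "real_distribution N"
    and "char N \<theta> = (CLINT \<omega>|M. complex_of_real (W \<omega>) * iexp (\<theta> * Y \<omega>)) / c"
    and "B \<in> sets borel \<Longrightarrow> measure N B = (\<integral>\<omega>. W \<omega> * indicator B (Y \<omega>) \<partial>M) / c"
proof -
  have [measurable]: "W \<in> borel_measurable M" using W by simp
  let ?D = "density M (\<lambda>\<omega>. ennreal (W \<omega> / c))"
  have "emeasure ?D (space ?D) = (\<integral>\<^sup>+ \<omega>. ennreal (W \<omega> / c) \<partial>M)"
    by (simp add: emeasure_density cong: nn_integral_cong)
  also have "\<dots> = ennreal (\<integral>\<omega>. W \<omega> / c \<partial>M)"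
    using W c by (intro nn_integral_eq_integral) auto
  also have "\<dots> = 1" using c by simp
  finally interpret D: prob_space ?D by (intro prob_spaceI)
  show "real_distribution N"
    unfolding N_def by (rule D.real_distribution_distr) simp
  have "char N \<theta> = (CLINT \<omega>|?D. iexp (\<theta> * Y \<omega>))"
    unfolding char_def N_def by (subst integral_distr) auto
  also have "\<dots> = (CLINT \<omega>|M. (W \<omega> / c) *\<^sub>R iexp (\<theta> * Y \<omega>))"
    using W c by (subst integral_density) auto
  also have "\<dots> = (CLINT \<omega>|M. (complex_of_real (W \<omega>) * iexp (\<theta> * Y \<omega>)) / c)"
    by (intro Bochner_Integration.integral_cong) (auto simp: scaleR_conv_of_real)
  finally show "char N \<theta> = (CLINT \<omega>|M. complex_of_real (W \<omega>) * iexp (\<theta> * Y \<omega>)) / c"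
    by simp
  assume B[measurable]: "B \<in> sets borel"
  interpret N: real_distribution N by fact
  have "measure N B = (\<integral>x. indicator B x \<partial>N)" by simp
  also have "\<dots> = (\<integral>\<omega>. indicator B (Y \<omega>) \<partial>?D)"
    unfolding N_def by (subst integral_distr) auto
  also have "\<dots> = (\<integral>\<omega>. (W \<omega> / c) *\<^sub>R indicator B (Y \<omega>) \<partial>M)"
    using W c by (subst integral_density) auto
  finally show "measure N B = (\<integral>\<omega>. W \<omega> * indicator B (Y \<omega>) \<partial>M) / c"
    by simp
qed

text \<open>
  The positive and the negative part of \<open>V\<close> give \<open>Y\<close> two distributions with the same characteristic
  function and, by the case \<open>\<theta> = 0\<close>, the same mass; Levy's uniqueness theorem identifies them.
\<close>

lemma (in prob_space) fourier_zero_imp_indicator_zero_real: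
  fixes V Y :: "'a \<Rightarrow> real"
  assumes V: "integrable M V" and Y[measurable]: "Y \<in> borel_measurable M"
    and F: "\<And>\<theta>. (CLINT \<omega>|M. complex_of_real (V \<omega>) * iexp (\<theta> * Y \<omega>)) = 0"
    and B[measurable]: "B \<in> sets borel"
  shows "(\<integral>\<omega>. V \<omega> * indicator B (Y \<omega>) \<partial>M) = 0"
proof -
  define P where "P \<omega> = max 0 (V \<omega>)" for \<omega>
  define Q where "Q \<omega> = max 0 (- V \<omega>)" for \<omega>
  have VPQ: "V \<omega> = P \<omega> - Q \<omega>" for \<omega> by (auto simp: P_def Q_def)
  have P: "integrable M P" "\<And>\<omega>. 0 \<le> P \<omega>" and Q: "integrable M Q" "\<And>\<omega>. 0 \<le> Q \<omega>"
    using V by (auto simp: P_def[abs_def] Q_def[abs_def])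
  have [measurable]: "P \<in> borel_measurable M" "Q \<in> borel_measurable M" using P Q by auto
  have iE: "integrable M (\<lambda>\<omega>. complex_of_real (W \<omega>) * iexp (\<theta> * Y \<omega>))"
    if "integrable M W" for W \<theta>
    by (rule Bochner_Integration.integrable_bound[OF that]) (use that in \<open>auto simp: norm_mult\<close>)
  have iB: "integrable M (\<lambda>\<omega>. W \<omega> * indicator B (Y \<omega>))"
    if "integrable M W" for W :: "'a \<Rightarrow> real"
    by (rule Bochner_Integration.integrable_bound[OF that]) (use that in \<open>auto split: split_indicator\<close>)
  have eqF: "(CLINT \<omega>|M. complex_of_real (P \<omega>) * iexp (\<theta> * Y \<omega>)) =
             (CLINT \<omega>|M. complex_of_real (Q \<omega>) * iexp (\<theta> * Y \<omega>))" for \<theta>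
  proof -
    have "0 = (CLINT \<omega>|M. complex_of_real (P \<omega>) * iexp (\<theta> * Y \<omega>) - complex_of_real (Q \<omega>) * iexp (\<theta> * Y \<omega>))"
      using F[of \<theta>] by (simp add: VPQ left_diff_distrib)
    also have "\<dots> = (CLINT \<omega>|M. complex_of_real (P \<omega>) * iexp (\<theta> * Y \<omega>)) -
             (CLINT \<omega>|M. complex_of_real (Q \<omega>) * iexp (\<theta> * Y \<omega>))"
      by (rule Bochner_Integration.integral_diff[OF iE[OF P(1)] iE[OF Q(1)]])
    finally show ?thesis by simp
  qed
  define c where "c = (\<integral>\<omega>. P \<omega> \<partial>M)"
  have cQ: "(\<integral>\<omega>. Q \<omega> \<partial>M) = c"
    using eqF[of 0] by (simp add: c_def)
  have "0 \<le> c" unfolding c_def using P by simp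
  have "(\<integral>\<omega>. P \<omega> * indicator B (Y \<omega>) \<partial>M) = (\<integral>\<omega>. Q \<omega> * indicator B (Y \<omega>) \<partial>M)"
  proof (cases "c = 0")
    case True
    have z: "(\<integral>\<omega>. W \<omega> * indicator B (Y \<omega>) \<partial>M) = 0"
      if W: "integrable M W" "\<And>\<omega>. 0 \<le> W \<omega>" "(\<integral>\<omega>. W \<omega> \<partial>M) = 0" for W :: "'a \<Rightarrow> real"
    proof (rule antisym)
      show "(\<integral>\<omega>. W \<omega> * indicator B (Y \<omega>) \<partial>M) \<le> 0"
        unfolding W(3)[symmetric]
        by (rule integral_mono[OF iB[OF W(1)] W(1)]) (auto split: split_indicator simp: W)
    qed (auto simp: W)
    show ?thesis using z[OF P] z[OF Q] cQ True c_def by simp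
  next
    case False
    with \<open>0 \<le> c\<close> have c0: "0 < c" by simp
    let ?N = "\<lambda>W. distr (density M (\<lambda>\<omega>. ennreal (W \<omega> / c))) borel Y"
    have "?N P = ?N Q"
    proof (rule Levy_uniqueness)
      show "char (?N P) = char (?N Q)"
        using weighted_char(2)[OF P c0 c_def[symmetric] Y] weighted_char(2)[OF Q c0 cQ Y] eqF
        by (intro ext) simp
    qed (rule weighted_char(1)[OF P c0 c_def[symmetric] Y] weighted_char(1)[OF Q c0 cQ Y])+
    then have "measure (?N P) B = measure (?N Q) B" by simp
    then show ?thesis
      using weighted_char(3)[OF P c0 c_def[symmetric] Y B] weighted_char(3)[OF Q c0 cQ Y B] c0
      by simp
  qed
  then show ?thesis
    by (simp add: VPQ left_diff_distrib Bochner_Integration.integral_diff[OF iB[OF P(1)] iB[OF Q(1)]])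
qed

text \<open>
  Conjugation exchanges the frequencies \<open>Y\<close> and \<open>- Y\<close>, so both hypotheses together are invariant
  under replacing \<open>V\<close> by its conjugate, and hence pass to the real and imaginary parts.
\<close>

lemma (in prob_space) fourier_zero_Re_Im:
  fixes V :: "'a \<Rightarrow> complex" and Y :: "'a \<Rightarrow> real"
  assumes V: "integrable M V" and [measurable]: "Y \<in> borel_measurable M"
    and F: "(CLINT \<omega>|M. V \<omega> * iexp (Y \<omega>)) = 0" "(CLINT \<omega>|M. V \<omega> * iexp (- Y \<omega>)) = 0"
  shows "(CLINT \<omega>|M. complex_of_real (Re (V \<omega>)) * iexp (Y \<omega>)) = 0"
    and "(CLINT \<omega>|M. complex_of_real (Im (V \<omega>)) * iexp (Y \<omega>)) = 0"
proof -
  have [measurable]: "V \<in> borel_measurable M" using V by simp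
  have i1: "integrable M (\<lambda>\<omega>. V \<omega> * iexp (Y \<omega>))"
    by (rule Bochner_Integration.integrable_bound[OF V]) (auto simp: norm_mult)
  have "integrable M (\<lambda>\<omega>. V \<omega> * iexp (- Y \<omega>))"
    by (rule Bochner_Integration.integrable_bound[OF V]) (auto simp: norm_mult)
  then have i2: "integrable M (\<lambda>\<omega>. cnj (V \<omega> * iexp (- Y \<omega>)))"
    by (rule integrable_cnj)
  have c: "(CLINT \<omega>|M. cnj (V \<omega> * iexp (- Y \<omega>))) = 0"
    using F(2) Bochner_Integration.integral_cnj[of M "\<lambda>\<omega>. V \<omega> * iexp (- Y \<omega>)"]
    by (simp only: complex_cnj_zero)
  have e: "cnj (iexp (- y)) = iexp y" for y by (simp add: exp_cnj)
  have "complex_of_real (Re (V \<omega>)) * iexp (Y \<omega>) = (V \<omega> * iexp (Y \<omega>) + cnj (V \<omega> * iexp (- Y \<omega>))) / 2" for \<omega>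
    unfolding complex_cnj_mult e by (simp add: complex_eq_iff algebra_simps)
  then show "(CLINT \<omega>|M. complex_of_real (Re (V \<omega>)) * iexp (Y \<omega>)) = 0"
    using F c by (simp only: integral_divide_zero Bochner_Integration.integral_add[OF i1 i2] add_0_left div_0)
  have "complex_of_real (Im (V \<omega>)) * iexp (Y \<omega>) = (V \<omega> * iexp (Y \<omega>) - cnj (V \<omega> * iexp (- Y \<omega>))) / (2 * \<i>)" for \<omega>
    unfolding complex_cnj_mult e left_diff_distrib[symmetric] complex_diff_cnj
    by (simp only: eq_divide_eq) (simp add: mult_ac)
  then show "(CLINT \<omega>|M. complex_of_real (Im (V \<omega>)) * iexp (Y \<omega>)) = 0"
    using F c by (simp only: integral_divide_zero Bochner_Integration.integral_diff[OF i1 i2] diff_self div_0)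
qed

lemma (in prob_space) fourier_zero_imp_indicator_zero:
  fixes V :: "'a \<Rightarrow> complex" and Y :: "'a \<Rightarrow> real"
  assumes V: "integrable M V" and Y[measurable]: "Y \<in> borel_measurable M"
    and F: "\<And>\<theta>. (CLINT \<omega>|M. V \<omega> * iexp (\<theta> * Y \<omega>)) = 0"
    and B[measurable]: "B \<in> sets borel"
  shows "(CLINT \<omega>|M. V \<omega> * indicator B (Y \<omega>)) = 0"
proof -
  have [measurable]: "V \<in> borel_measurable M" using V by simp
  have F': "(CLINT \<omega>|M. V \<omega> * iexp (- (\<theta> * Y \<omega>))) = 0" for \<theta>
    using F[of "- \<theta>"] by simp
  have i: "integrable M (\<lambda>\<omega>. V \<omega> * indicator B (Y \<omega>))"
    by (rule Bochner_Integration.integrable_bound[OF V]) (auto split: split_indicator)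
  have re: "Re (V \<omega> * indicator B (Y \<omega>)) = Re (V \<omega>) * indicator B (Y \<omega>)"
   and im: "Im (V \<omega> * indicator B (Y \<omega>)) = Im (V \<omega>) * indicator B (Y \<omega>)" for \<omega>
    by (auto split: split_indicator)
  have "(\<integral>\<omega>. Re (V \<omega>) * indicator B (Y \<omega>) \<partial>M) = 0"
    using fourier_zero_Re_Im(1)[OF V _ F F'] V
    by (intro fourier_zero_imp_indicator_zero_real B Y) auto
  moreover have "(\<integral>\<omega>. Im (V \<omega>) * indicator B (Y \<omega>) \<partial>M) = 0"
    using fourier_zero_Re_Im(2)[OF V _ F F'] V
    by (intro fourier_zero_imp_indicator_zero_real B Y) auto
  ultimately show ?thesis
    using integral_Re[OF i] integral_Im[OF i] unfolding re im
    by (simp add: complex_eq_iff)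
qed

text \<open>
  The uniqueness theorem in several variables, reduced to one variable: in the induction one
  exponential factor after the other is exchanged for an indicator, the exponentials that remain
  and the indicators already obtained being absorbed into the complex weight \<open>V\<close>.
\<close>

lemma (in prob_space) fourier_zero_imp_rectangle_zero:
  fixes V :: "'a \<Rightarrow> complex" and Y :: "'i \<Rightarrow> 'a \<Rightarrow> real"
  assumes "finite I" and "\<And>i. i \<in> I \<Longrightarrow> Y i \<in> borel_measurable M"
    and "integrable M V"
    and "\<And>\<theta>. (CLINT \<omega>|M. V \<omega> * iexp (\<Sum>i\<in>I. \<theta> i * Y i \<omega>)) = 0"
    and "\<And>i. i \<in> I \<Longrightarrow> B i \<in> sets borel"
  shows "(CLINT \<omega>|M. V \<omega> * (\<Prod>i\<in>I. indicator (B i) (Y i \<omega>))) = 0"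
  using assms
proof (induction I arbitrary: V)
  case empty
  then show ?case by simp
next
  case (insert k I)
  have [measurable]: "Y k \<in> borel_measurable M" "B k \<in> sets borel" "V \<in> borel_measurable M"
    using insert.prems by auto
  have [measurable]: "Y i \<in> borel_measurable M" if "i \<in> I" for i
    using insert.prems that by auto
  have V: "integrable M (\<lambda>\<omega>. V \<omega> * indicator (B k) (Y k \<omega>))"
    by (rule Bochner_Integration.integrable_bound[OF insert.prems(2)]) (auto split: split_indicator)
  have *: "(CLINT \<omega>|M. V \<omega> * indicator (B k) (Y k \<omega>) * iexp (\<Sum>i\<in>I. \<theta> i * Y i \<omega>)) = 0" for \<theta>
  proof -
    have "(CLINT \<omega>|M. V \<omega> * iexp (\<Sum>i\<in>I. \<theta> i * Y i \<omega>) * indicator (B k) (Y k \<omega>)) = 0"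
    proof (rule fourier_zero_imp_indicator_zero)
      show "integrable M (\<lambda>\<omega>. V \<omega> * iexp (\<Sum>i\<in>I. \<theta> i * Y i \<omega>))"
        by (rule Bochner_Integration.integrable_bound[OF insert.prems(2)]) (auto simp: norm_mult)
      fix \<tau>
      have "V \<omega> * iexp (\<Sum>i\<in>insert k I. (\<theta>(k := \<tau>)) i * Y i \<omega>) =
          V \<omega> * iexp (\<Sum>i\<in>I. \<theta> i * Y i \<omega>) * iexp (\<tau> * Y k \<omega>)" for \<omega>
      proof -
        have "(\<Sum>i\<in>I. (\<theta>(k := \<tau>)) i * Y i \<omega>) = (\<Sum>i\<in>I. \<theta> i * Y i \<omega>)"
          using insert.hyps by (intro sum.cong) auto
        then have "(\<Sum>i\<in>insert k I. (\<theta>(k := \<tau>)) i * Y i \<omega>) = \<tau> * Y k \<omega> + (\<Sum>i\<in>I. \<theta> i * Y i \<omega>)"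
          using insert.hyps by simp
        then show ?thesis by (simp add: exp_add distrib_left)
      qed
      then show "(CLINT \<omega>|M. V \<omega> * iexp (\<Sum>i\<in>I. \<theta> i * Y i \<omega>) * iexp (\<tau> * Y k \<omega>)) = 0"
        using insert.prems(3)[of "\<theta>(k := \<tau>)"] by (simp only:)
    qed auto
    then show ?thesis by (simp add: mult_ac)
  qed
  have "(CLINT \<omega>|M. V \<omega> * indicator (B k) (Y k \<omega>) * (\<Prod>i\<in>I. indicator (B i) (Y i \<omega>))) = 0"
    using insert.prems by (intro insert.IH V *) auto
  then show ?case using insert.hyps by (simp add: mult_ac)
qed

lemma sets_generated_by:
  "sets (generated_by M I Y) =
     {(\<lambda>\<omega>. \<lambda>i\<in>I. Y i \<omega>) -` A \<inter> space M | A. A \<in> sets (\<Pi>\<^sub>M i\<in>I. borel)}"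
  unfolding generated_by_def
  by (rule sets_vimage_algebra2) (auto simp: space_PiM)

lemma subalgebra_generated_by:
  assumes "\<And>i. i \<in> I \<Longrightarrow> Y i \<in> borel_measurable M"
  shows "subalgebra M (generated_by M I Y)"
proof -
  have [measurable]: "(\<lambda>\<omega>. \<lambda>i\<in>I. Y i \<omega>) \<in> measurable M (\<Pi>\<^sub>M i\<in>I. borel)"
    using assms by (intro measurable_restrict) auto
  show ?thesis
    unfolding subalgebra_def sets_generated_by
    by (auto simp: generated_by_def)
qed

lemma measurable_generated_by:
  assumes "i \<in> I"
  shows "Y i \<in> borel_measurable (generated_by M I Y)"
proof -
  have "(\<lambda>\<omega>. \<lambda>i\<in>I. Y i \<omega>) \<in> measurable (generated_by M I Y) (\<Pi>\<^sub>M i\<in>I. borel)"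
    unfolding generated_by_def by (rule measurable_vimage_algebra1) (auto simp: space_PiM)
  from measurable_compose[OF this measurable_component_singleton[OF assms]] assms
  show ?thesis by simp
qed

text \<open>
  The positive and the negative part of \<open>V\<close> induce finite measures on the product space that agree
  on rectangles, hence everywhere. So \<open>V\<close> integrates to zero over every event generated by \<open>Y\<close>.
\<close>

lemma (in prob_space) fourier_zero_imp_cond_exp_zero:
  fixes V :: "'a \<Rightarrow> real" and Y :: "'i \<Rightarrow> 'a \<Rightarrow> real"
  assumes I: "finite I" and Y: "\<And>i. i \<in> I \<Longrightarrow> Y i \<in> borel_measurable M"
    and V: "integrable M V"
    and F: "\<And>\<theta>. (CLINT \<omega>|M. complex_of_real (V \<omega>) * iexp (\<Sum>i\<in>I. \<theta> i * Y i \<omega>)) = 0"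
  shows "AE \<omega> in M. real_cond_exp M (generated_by M I Y) V \<omega> = 0"
proof -
  let ?X = "\<lambda>\<omega>. \<lambda>i\<in>I. Y i \<omega>" and ?P = "\<Pi>\<^sub>M i\<in>I. (borel :: real measure)"
  have X[measurable]: "?X \<in> measurable M ?P"
    using Y by (intro measurable_restrict) auto
  interpret sigma_finite_subalgebra M "generated_by M I Y"
    by (intro finite_measure_subalgebra_is_sigma_finite finite_measure_subalgebra.intro
          finite_measure_subalgebra_axioms.intro subalgebra_generated_by Y) unfold_locales
  define P where "P \<omega> = max 0 (V \<omega>)" for \<omega>
  define Q where "Q \<omega> = max 0 (- V \<omega>)" for \<omega>
  have VPQ: "V \<omega> = P \<omega> - Q \<omega>" for \<omega> by (auto simp: P_def Q_def)
  have P: "integrable M P" "\<And>\<omega>. 0 \<le> P \<omega>" and Q: "integrable M Q" "\<And>\<omega>. 0 \<le> Q \<omega>"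
    using V by (auto simp: P_def[abs_def] Q_def[abs_def])
  have [measurable]: "V \<in> borel_measurable M" "P \<in> borel_measurable M" "Q \<in> borel_measurable M"
    using V P Q by auto
  have iA: "integrable M (\<lambda>\<omega>. W \<omega> * indicator A (?X \<omega>))"
    if "integrable M W" "A \<in> sets ?P" for W :: "'a \<Rightarrow> real" and A
    by (rule Bochner_Integration.integrable_bound[OF that(1)])
      (use that in \<open>auto split: split_indicator\<close>)
  let ?N = "\<lambda>W. distr (density M (\<lambda>\<omega>. ennreal (W \<omega>))) ?P ?X"
  have N: "emeasure (?N W) A = ennreal (\<integral>\<omega>. W \<omega> * indicator A (?X \<omega>) \<partial>M)"
    if W: "integrable M W" "\<And>\<omega>. 0 \<le> W \<omega>" and A[measurable]: "A \<in> sets ?P" for W A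
  proof -
    have [measurable]: "W \<in> borel_measurable M" using W by simp
    have "emeasure (?N W) A = (\<integral>\<^sup>+\<omega>. ennreal (W \<omega>) * indicator (?X -` A \<inter> space M) \<omega> \<partial>M)"
      by (simp add: emeasure_distr emeasure_density)
    also have "\<dots> = (\<integral>\<^sup>+\<omega>. ennreal (W \<omega> * indicator A (?X \<omega>)) \<partial>M)"
      by (intro nn_integral_cong) (auto split: split_indicator)
    also have "\<dots> = ennreal (\<integral>\<omega>. W \<omega> * indicator A (?X \<omega>) \<partial>M)"
      using W iA[OF W(1) A] by (intro nn_integral_eq_integral) auto
    finally show ?thesis .
  qed
  have "?N P = ?N Q"
  proof (rule measure_eqI_PiM_finite[OF I])
    fix A :: "'i \<Rightarrow> real set" assume A: "\<And>i. i \<in> I \<Longrightarrow> A i \<in> sets borel"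
    have R: "Pi\<^sub>E I A \<in> sets ?P" using I A by (intro sets_PiM_I_finite) auto
    have "(CLINT \<omega>|M. complex_of_real (V \<omega>) * (\<Prod>i\<in>I. indicator (A i) (Y i \<omega>))) = 0"
      using V by (intro fourier_zero_imp_rectangle_zero I Y F A) auto
    moreover have "complex_of_real (V \<omega>) * (\<Prod>i\<in>I. indicator (A i) (Y i \<omega>)) =
        complex_of_real (V \<omega> * indicator (Pi\<^sub>E I A) (?X \<omega>))" for \<omega>
      using I by (auto simp: indicator_def PiE_iff prod_zero_iff of_real_prod)
    ultimately have "(\<integral>\<omega>. V \<omega> * indicator (Pi\<^sub>E I A) (?X \<omega>) \<partial>M) = 0"
      by (simp only: integral_complex_of_real of_real_eq_0_iff)
    then have "(\<integral>\<omega>. P \<omega> * indicator (Pi\<^sub>E I A) (?X \<omega>) \<partial>M) = (\<integral>\<omega>. Q \<omega> * indicator (Pi\<^sub>E I A) (?X \<omega>) \<partial>M)"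
      by (simp add: VPQ left_diff_distrib
          Bochner_Integration.integral_diff[OF iA[OF P(1) R] iA[OF Q(1) R]])
    then show "emeasure (?N P) (Pi\<^sub>E I A) = emeasure (?N Q) (Pi\<^sub>E I A)"
      by (simp add: N[OF P R] N[OF Q R])
  next
    show "range (\<lambda>n::nat. space ?P) \<subseteq> prod_algebra I (\<lambda>i. borel)"
      using I by (auto simp: space_PiM intro!: prod_algebraI_finite)
    show "emeasure (?N P) (space ?P) \<noteq> \<infinity>"
      by (subst N[OF P]) auto
  qed auto
  then have eq: "(\<integral>\<omega>. P \<omega> * indicator A (?X \<omega>) \<partial>M) = (\<integral>\<omega>. Q \<omega> * indicator A (?X \<omega>) \<partial>M)"
    if "A \<in> sets ?P" for A
    using N[OF P that] N[OF Q that] P Q by (simp add: integral_nonneg_AE)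
  show ?thesis
  proof (rule real_cond_exp_charact)
    fix C assume "C \<in> sets (generated_by M I Y)"
    then obtain A where C: "C = ?X -` A \<inter> space M" and A: "A \<in> sets ?P"
      unfolding sets_generated_by by auto
    have "(\<integral>\<omega>\<in>C. V \<omega> \<partial>M) = (\<integral>\<omega>. V \<omega> * indicator A (?X \<omega>) \<partial>M)"
      unfolding set_lebesgue_integral_def C
      by (intro Bochner_Integration.integral_cong) (auto split: split_indicator)
    also have "\<dots> = 0"
      using eq[OF A] by (simp add: VPQ left_diff_distrib
          Bochner_Integration.integral_diff[OF iA[OF P(1) A] iA[OF Q(1) A]])
    finally show "(\<integral>\<omega>\<in>C. V \<omega> \<partial>M) = (\<integral>\<omega>\<in>C. 0 \<partial>M)" by simp
  qed (use V in auto)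
qed

section \<open>Square-integrable and Gaussian random variables\<close>

context prob_space
begin

definition square_integrable :: "('a \<Rightarrow> real) set" where
  "square_integrable = {X. X \<in> borel_measurable M \<and> integrable M (\<lambda>\<omega>. (X \<omega>)\<^sup>2)}"

definition inner2 :: "('a \<Rightarrow> real) \<Rightarrow> ('a \<Rightarrow> real) \<Rightarrow> real" where
  "inner2 X Y = (\<integral>\<omega>. X \<omega> * Y \<omega> \<partial>M)"

lemma square_integrable_measurable: "X \<in> square_integrable \<Longrightarrow> X \<in> borel_measurable M"
  by (simp add: square_integrable_def)

lemma square_integrable_imp_integrable_mult:
  assumes "X \<in> square_integrable" "Y \<in> square_integrable"
  shows "integrable M (\<lambda>\<omega>. X \<omega> * Y \<omega>)"
proof (rule Bochner_Integration.integrable_bound)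
  show "integrable M (\<lambda>\<omega>. (X \<omega>)\<^sup>2 + (Y \<omega>)\<^sup>2)"
    using assms by (auto simp: square_integrable_def)
  have "\<bar>x * y\<bar> \<le> x\<^sup>2 + y\<^sup>2" for x y :: real
  proof -
    have "2 * \<bar>x * y\<bar> \<le> x\<^sup>2 + y\<^sup>2"
      using sum_squares_bound[of "\<bar>x\<bar>" "\<bar>y\<bar>"] by (simp add: abs_mult)
    moreover have "0 \<le> \<bar>x * y\<bar>" by simp
    ultimately show ?thesis by linarith
  qed
  then show "AE \<omega> in M. norm (X \<omega> * Y \<omega>) \<le> norm ((X \<omega>)\<^sup>2 + (Y \<omega>)\<^sup>2)"
    by (intro always_eventually) auto
qed (use assms in \<open>auto simp: square_integrable_def\<close>)

lemma const_square_integrable: "(\<lambda>_. c) \<in> square_integrable"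
  by (simp add: square_integrable_def)

lemma square_integrable_imp_integrable: "X \<in> square_integrable \<Longrightarrow> integrable M X"
  using square_integrable_imp_integrable_mult[OF _ const_square_integrable, of X 1] by simp

lemma square_integrable_add:
  assumes "X \<in> square_integrable" "Y \<in> square_integrable"
  shows "(\<lambda>\<omega>. X \<omega> + Y \<omega>) \<in> square_integrable"
  using assms square_integrable_imp_integrable_mult[OF assms]
  by (auto simp: square_integrable_def power2_sum mult.assoc)

lemma square_integrable_cmult:
  assumes "X \<in> square_integrable"
  shows "(\<lambda>\<omega>. c * X \<omega>) \<in> square_integrable"
  using assms by (auto simp: square_integrable_def power_mult_distrib)

lemma square_integrable_diff:
  assumes "X \<in> square_integrable" "Y \<in> square_integrable"
  shows "(\<lambda>\<omega>. X \<omega> - Y \<omega>) \<in> square_integrable"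
  using square_integrable_add[OF assms(1) square_integrable_cmult[OF assms(2), of "- 1"]] by simp

lemma square_integrable_sum:
  assumes "\<And>i. i \<in> I \<Longrightarrow> Y i \<in> square_integrable"
  shows "(\<lambda>\<omega>. \<Sum>i\<in>I. a i * Y i \<omega>) \<in> square_integrable"
  using assms
proof (induction I rule: infinite_finite_induct)
  case (insert k I)
  have "(\<lambda>\<omega>. a k * Y k \<omega> + (\<Sum>i\<in>I. a i * Y i \<omega>)) \<in> square_integrable"
    using insert by (intro square_integrable_add square_integrable_cmult) auto
  then show ?case using insert.hyps by simp
qed (simp_all add: const_square_integrable)

lemma inner2_commute: "inner2 X Y = inner2 Y X"
  by (simp add: inner2_def mult.commute)

lemma inner2_diff_left:
  assumes "X \<in> square_integrable" "Y \<in> square_integrable" "W \<in> square_integrable"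
  shows "inner2 (\<lambda>\<omega>. X \<omega> - Y \<omega>) W = inner2 X W - inner2 Y W"
  unfolding inner2_def using assms
  by (simp add: left_diff_distrib square_integrable_imp_integrable_mult)

lemma inner2_add_left:
  assumes "X \<in> square_integrable" "Y \<in> square_integrable" "W \<in> square_integrable"
  shows "inner2 (\<lambda>\<omega>. X \<omega> + Y \<omega>) W = inner2 X W + inner2 Y W"
  unfolding inner2_def using assms
  by (simp add: distrib_right square_integrable_imp_integrable_mult)

lemma inner2_cmult_left: "inner2 (\<lambda>\<omega>. c * X \<omega>) W = c * inner2 X W"
  unfolding inner2_def by (simp add: mult.assoc)

lemma inner2_sum_left:
  assumes "\<And>i. i \<in> I \<Longrightarrow> Y i \<in> square_integrable" "W \<in> square_integrable"
  shows "inner2 (\<lambda>\<omega>. \<Sum>i\<in>I. a i * Y i \<omega>) W = (\<Sum>i\<in>I. a i * inner2 (Y i) W)"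
proof -
  have "integrable M (\<lambda>\<omega>. a i * Y i \<omega> * W \<omega>)" if "i \<in> I" for i
    using square_integrable_imp_integrable_mult[OF square_integrable_cmult[OF assms(1)[OF that]] assms(2)] .
  then show ?thesis
    unfolding inner2_def sum_distrib_right
    by (subst Bochner_Integration.integral_sum) (auto simp: mult.assoc)
qed

lemma inner2_sum_sum:
  assumes "\<And>i. i \<in> I \<Longrightarrow> Y i \<in> square_integrable" "\<And>j. j \<in> J \<Longrightarrow> W j \<in> square_integrable"
  shows "inner2 (\<lambda>\<omega>. \<Sum>i\<in>I. a i * Y i \<omega>) (\<lambda>\<omega>. \<Sum>j\<in>J. b j * W j \<omega>) =
    (\<Sum>i\<in>I. \<Sum>j\<in>J. a i * b j * inner2 (Y i) (W j))"
proof -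
  have "inner2 (\<lambda>\<omega>. \<Sum>i\<in>I. a i * Y i \<omega>) (\<lambda>\<omega>. \<Sum>j\<in>J. b j * W j \<omega>) =
     (\<Sum>i\<in>I. a i * inner2 (Y i) (\<lambda>\<omega>. \<Sum>j\<in>J. b j * W j \<omega>))"
    using assms by (intro inner2_sum_left square_integrable_sum)
  also have "\<dots> = (\<Sum>i\<in>I. a i * (\<Sum>j\<in>J. b j * inner2 (Y i) (W j)))"
    using assms by (intro sum.cong refl arg_cong2[where f="(*)"], subst (1 2) inner2_commute)
      (auto simp: inner2_sum_left)
  finally show ?thesis by (simp add: sum_distrib_left mult.assoc)
qed

text \<open>
  The covariance form is only semidefinite: a null vector vanishes almost surely, which makes it
  orthogonal to everything. This covers the degenerate step of the orthogonalisation below.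
\<close>

lemma inner2_null_left:
  assumes X: "X \<in> square_integrable" and "inner2 X X = 0"
  shows "inner2 X Y = 0"
proof -
  have "AE \<omega> in M. X \<omega> * X \<omega> = 0"
    using integral_nonneg_eq_0_iff_AE[OF square_integrable_imp_integrable_mult[OF X X]] assms
    by (simp add: inner2_def)
  then have "AE \<omega> in M. X \<omega> * Y \<omega> = 0" by eventually_elim simp
  then show ?thesis unfolding inner2_def by (rule integral_eq_zero_AE)
qed

text \<open>
  One Gram-Schmidt step per index: project both \<open>X\<close> and the new variable \<open>Y k\<close> onto the span of
  the old ones, and remove from the residual of \<open>X\<close> its component along the residual of \<open>Y k\<close>.
\<close>

lemma exists_orthogonal_residual:
  assumes "finite I" "\<And>i. i \<in> I \<Longrightarrow> Y i \<in> square_integrable" "X \<in> square_integrable"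
  shows "\<exists>a. \<forall>i\<in>I. inner2 (\<lambda>\<omega>. X \<omega> - (\<Sum>j\<in>I. a j * Y j \<omega>)) (Y i) = 0"
  using assms
proof (induction I arbitrary: X)
  case empty
  then show ?case by simp
next
  case (insert k I)
  have YI: "\<And>i. i \<in> I \<Longrightarrow> Y i \<in> square_integrable" and Yk: "Y k \<in> square_integrable"
    using insert.prems by auto
  obtain a where a: "\<forall>i\<in>I. inner2 (\<lambda>\<omega>. X \<omega> - (\<Sum>j\<in>I. a j * Y j \<omega>)) (Y i) = 0"
    using insert.IH[OF YI insert.prems(2)] by blast
  obtain c where c: "\<forall>i\<in>I. inner2 (\<lambda>\<omega>. Y k \<omega> - (\<Sum>j\<in>I. c j * Y j \<omega>)) (Y i) = 0"
    using insert.IH[OF YI Yk] by blast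
  define x where "x \<omega> = X \<omega> - (\<Sum>j\<in>I. a j * Y j \<omega>)" for \<omega>
  define z where "z \<omega> = Y k \<omega> - (\<Sum>j\<in>I. c j * Y j \<omega>)" for \<omega>
  have x: "x \<in> square_integrable" and z: "z \<in> square_integrable"
    unfolding x_def[abs_def] z_def[abs_def] using YI Yk insert.prems(2)
    by (auto intro!: square_integrable_diff square_integrable_sum)
  \<comment> \<open>If \<open>z\<close> is a null vector, division by zero gives \<open>\<beta> = 0\<close>, which is the right choice.\<close>
  define \<beta> where "\<beta> = inner2 x z / inner2 z z"
  define e where "e \<omega> = x \<omega> - \<beta> * z \<omega>" for \<omega>
  have e: "e \<in> square_integrable"
    unfolding e_def[abs_def] by (intro square_integrable_diff square_integrable_cmult x z)
  have eI: "inner2 e (Y i) = 0" if "i \<in> I" for i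
    using a c that unfolding e_def[abs_def]
    by (simp add: inner2_diff_left inner2_cmult_left x z square_integrable_cmult YI
         flip: x_def[abs_def] z_def[abs_def])
  have "inner2 e z = inner2 x z - \<beta> * inner2 z z"
    unfolding e_def[abs_def]
    by (simp add: inner2_diff_left inner2_cmult_left x z square_integrable_cmult)
  then have ez: "inner2 e z = 0"
    using inner2_null_left[OF z, of x] unfolding \<beta>_def
    by (cases "inner2 z z = 0") (auto simp: inner2_commute[of x z])
  have Yk_eq: "Y k = (\<lambda>\<omega>. z \<omega> + (\<Sum>j\<in>I. c j * Y j \<omega>))"
    by (auto simp: z_def)
  have "inner2 (Y k) e = inner2 z e + (\<Sum>j\<in>I. c j * inner2 (Y j) e)"
    by (subst Yk_eq, subst inner2_add_left) (auto simp: z e YI square_integrable_sum inner2_sum_left)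
  then have ek: "inner2 e (Y k) = 0"
    using eI ez by (simp add: inner2_commute[of _ e])
  let ?a = "\<lambda>j. if j = k then \<beta> else a j - \<beta> * c j"
  have "e = (\<lambda>\<omega>. X \<omega> - (\<Sum>j\<in>insert k I. ?a j * Y j \<omega>))"
  proof
    fix \<omega>
    have "(\<Sum>j\<in>I. ?a j * Y j \<omega>) = (\<Sum>j\<in>I. a j * Y j \<omega> - \<beta> * (c j * Y j \<omega>))"
      using insert.hyps by (intro sum.cong) (auto simp: algebra_simps)
    then show "e \<omega> = X \<omega> - (\<Sum>j\<in>insert k I. ?a j * Y j \<omega>)"
      using insert.hyps
      by (simp add: e_def x_def z_def sum_subtractf sum_distrib_left algebra_simps)
  qed
  then show ?case using eI ek by (intro exI[of _ ?a]) auto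
qed

lemma gaussian_rv_centered:
  assumes G: "gaussian_rv M X" and mean: "(\<integral>\<omega>. X \<omega> \<partial>M) = 0"
  shows "X \<in> square_integrable" "(CLINT \<omega>|M. iexp (X \<omega>)) = exp (- inner2 X X / 2)"
proof -
  have X[measurable]: "X \<in> borel_measurable M" using G by (simp add: gaussian_rv_def)
  consider (const) \<mu> where "AE \<omega> in M. X \<omega> = \<mu>"
    | (normal) \<mu> \<sigma> where "0 < \<sigma>" "distributed M lborel X (normal_density \<mu> \<sigma>)"
    using G by (auto simp: gaussian_rv_def)
  then have "X \<in> square_integrable \<and> (CLINT \<omega>|M. iexp (X \<omega>)) = exp (- inner2 X X / 2)"
  proof cases
    case const
    have "(\<integral>\<omega>. X \<omega> \<partial>M) = (\<integral>\<omega>. \<mu> \<partial>M)"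
      using const by (intro integral_cong_AE) auto
    then have "\<mu> = 0" using mean by (simp add: prob_space)
    then have 0: "AE \<omega> in M. X \<omega> = 0" using const by simp
    have "integrable M (\<lambda>\<omega>. (X \<omega>)\<^sup>2) \<longleftrightarrow> integrable M (\<lambda>\<omega>. 0 :: real)"
      using 0 by (intro integrable_cong_AE) auto
    moreover have "inner2 X X = (\<integral>\<omega>. 0 \<partial>M)"
      unfolding inner2_def using 0 by (intro integral_cong_AE) auto
    moreover have "(CLINT \<omega>|M. iexp (X \<omega>)) = (CLINT \<omega>|M. 1)"
      using 0 by (intro integral_cong_AE) auto
    ultimately show ?thesis by (simp add: square_integrable_def prob_space)
  next
    case normal
    have \<mu>: "\<mu> = 0" using normal_distributed_expectation[OF normal] mean by simp
    have sq: "integrable M (\<lambda>\<omega>. (X \<omega>)\<^sup>2)"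
      using distributed_integrable[OF normal(2), of "\<lambda>x. x\<^sup>2"] integrable_normal_moment[OF normal(1), of 0 2] \<mu>
      by simp
    have "variance X = \<sigma>\<^sup>2" by (rule normal_distributed_variance[OF normal])
    then have var: "inner2 X X = \<sigma>\<^sup>2"
      using mean by (simp add: inner2_def power2_eq_square)
    have std: "distributed M lborel (\<lambda>\<omega>. X \<omega> / \<sigma>) std_normal_density"
      using normal normal_standard_normal_convert[OF normal(1), of X \<mu>] \<mu> by simp
    have "(CLINT \<omega>|M. iexp (X \<omega>)) = (CLINT \<omega>|M. iexp (\<sigma> * (X \<omega> / \<sigma>)))"
      using normal(1) by simp
    also have "\<dots> = (CLINT x|distr M lborel (\<lambda>\<omega>. X \<omega> / \<sigma>). iexp (\<sigma> * x))"
      by (subst integral_distr) auto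
    also have "\<dots> = char std_normal_distribution \<sigma>"
      unfolding char_def by (simp add: distributed_distr_eq_density[OF std])
    also have "\<dots> = exp (- inner2 X X / 2)"
      by (simp add: char_std_normal_distribution var)
    finally show ?thesis using sq by (simp add: square_integrable_def)
  qed
  then show "X \<in> square_integrable" "(CLINT \<omega>|M. iexp (X \<omega>)) = exp (- inner2 X X / 2)" by auto
qed

text \<open>
  Uncorrelated jointly Gaussian variables are independent, in the only form that is used. The
  characteristic function of \<open>\<tau> * e + L\<close> factorises, so \<open>V = exp (\<i> L) - E (exp (\<i> L))\<close> is
  orthogonal to all \<open>exp (\<i> \<tau> e)\<close>. Its conditional expectation given \<open>e\<close> is therefore zero, and
  \<open>V\<close> is orthogonal to the powers of \<open>e\<close>.
\<close>

lemma uncorrelated_gaussian_moment: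
  assumes G: "\<And>\<tau> \<rho>. gaussian_rv M (\<lambda>\<omega>. \<tau> * e \<omega> + \<rho> * L \<omega>)"
    and mean: "(\<integral>\<omega>. e \<omega> \<partial>M) = 0" "(\<integral>\<omega>. L \<omega> \<partial>M) = 0"
    and sq: "e \<in> square_integrable" "L \<in> square_integrable"
    and orth: "inner2 e L = 0"
    and k: "integrable M (\<lambda>\<omega>. e \<omega> ^ k)"
  shows "(CLINT \<omega>|M. complex_of_real (e \<omega> ^ k) * iexp (L \<omega>)) =
     complex_of_real (\<integral>\<omega>. e \<omega> ^ k \<partial>M) * (CLINT \<omega>|M. iexp (L \<omega>))"
proof -
  have [measurable]: "e \<in> borel_measurable M" "L \<in> borel_measurable M"
    using sq by (auto simp: square_integrable_def)
  have int: "integrable M e" "integrable M L"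
    using sq by (auto intro: square_integrable_imp_integrable)
  have ch: "(CLINT \<omega>|M. iexp (\<tau> * e \<omega> + \<rho> * L \<omega>)) =
      exp (- (\<tau>\<^sup>2 * inner2 e e) / 2) * exp (- (\<rho>\<^sup>2 * inner2 L L) / 2)" for \<tau> \<rho>
  proof -
    let ?X = "\<lambda>\<omega>. \<tau> * e \<omega> + \<rho> * L \<omega>"
    have "inner2 ?X ?X = \<tau> * inner2 e ?X + \<rho> * inner2 L ?X"
      using sq by (simp add: inner2_add_left square_integrable_add square_integrable_cmult inner2_cmult_left)
    moreover have "inner2 e ?X = \<tau> * inner2 e e" "inner2 L ?X = \<rho> * inner2 L L"
      using sq orth inner2_commute[of e L]
      by (simp_all add: inner2_commute[of _ ?X] inner2_add_left square_integrable_cmult inner2_cmult_left)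
    ultimately have "inner2 ?X ?X = \<tau>\<^sup>2 * inner2 e e + \<rho>\<^sup>2 * inner2 L L"
      by (simp add: power2_eq_square)
    moreover have "(\<integral>\<omega>. ?X \<omega> \<partial>M) = 0" using mean int by simp
    ultimately show ?thesis
      using gaussian_rv_centered(2)[OF G[of \<tau> \<rho>]]
      by (simp add: add_divide_distrib exp_add[symmetric] flip: of_real_mult)
  qed
  define c where "c = (CLINT \<omega>|M. iexp (L \<omega>))"
  define V where "V \<omega> = iexp (L \<omega>) - c" for \<omega>
  have V: "integrable M V"
    unfolding V_def[abs_def] by (intro Bochner_Integration.integrable_diff integrable_iexp) auto
  have F: "(CLINT \<omega>|M. V \<omega> * iexp (\<tau> * e \<omega>)) = 0" for \<tau>
  proof -
    have "(CLINT \<omega>|M. V \<omega> * iexp (\<tau> * e \<omega>)) =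
       (CLINT \<omega>|M. iexp (\<tau> * e \<omega> + 1 * L \<omega>) - c * iexp (\<tau> * e \<omega> + 0 * L \<omega>))"
      by (intro Bochner_Integration.integral_cong refl)
        (simp add: V_def left_diff_distrib exp_add distrib_left)
    also have "\<dots> = (CLINT \<omega>|M. iexp (\<tau> * e \<omega> + 1 * L \<omega>)) - c * (CLINT \<omega>|M. iexp (\<tau> * e \<omega> + 0 * L \<omega>))"
      by (subst Bochner_Integration.integral_diff) (auto intro!: integrable_iexp integrable_mult_right)
    also have "\<dots> = 0"
    proof -
      have "c = exp (- inner2 L L / 2)" using ch[of 0 1] by (simp add: c_def)
      then show ?thesis unfolding ch by simp
    qed
    finally show ?thesis .
  qed
  have F': "(CLINT \<omega>|M. V \<omega> * iexp (- (\<tau> * e \<omega>))) = 0" for \<tau>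
    using F[of "- \<tau>"] by simp
  let ?F = "generated_by M {()} (\<lambda>_. e)"
  interpret finite_measure_subalgebra M ?F
    by unfold_locales (rule subalgebra_generated_by, simp)
  have *: "(\<integral>\<omega>. e \<omega> ^ k * W \<omega> \<partial>M) = 0"
    if W: "integrable M W" and Wk: "integrable M (\<lambda>\<omega>. e \<omega> ^ k * W \<omega>)"
      and FW: "\<And>\<tau>. (CLINT \<omega>|M. complex_of_real (W \<omega>) * iexp (\<tau> * e \<omega>)) = 0" for W
  proof -
    have [measurable]: "e \<in> borel_measurable ?F"
      using measurable_generated_by[of "()" "{()}" "\<lambda>_. e" M] by simp
    have [measurable]: "W \<in> borel_measurable M" using W by simp
    have "AE \<omega> in M. real_cond_exp M ?F W \<omega> = 0"
      by (rule fourier_zero_imp_cond_exp_zero) (use W FW in auto)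
    then have "(\<integral>\<omega>. e \<omega> ^ k * real_cond_exp M ?F W \<omega> \<partial>M) = 0"
      by (intro integral_eq_zero_AE) (auto elim: eventually_mono)
    then show ?thesis
      using real_cond_exp_intg(2)[OF Wk] by simp
  qed
  have Vk: "integrable M (\<lambda>\<omega>. complex_of_real (e \<omega> ^ k) * V \<omega>)"
  proof (rule Bochner_Integration.integrable_bound[OF integrable_mult_right[OF k, of "1 + norm c"]])
    have "norm (V \<omega>) \<le> 1 + norm c" for \<omega>
      unfolding V_def by (rule norm_triangle_ineq4[THEN order.trans]) simp
    then show "AE \<omega> in M. norm (complex_of_real (e \<omega> ^ k) * V \<omega>) \<le> norm ((1 + norm c) * e \<omega> ^ k)"
      by (intro always_eventually allI) (simp add: norm_mult norm_power abs_mult power_abs mult.commute mult_right_mono)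
  qed (unfold V_def[abs_def], measurable)
  have re: "Re (complex_of_real (e \<omega> ^ k) * V \<omega>) = e \<omega> ^ k * Re (V \<omega>)"
   and im: "Im (complex_of_real (e \<omega> ^ k) * V \<omega>) = e \<omega> ^ k * Im (V \<omega>)" for \<omega>
    by simp_all
  have "(\<integral>\<omega>. e \<omega> ^ k * Re (V \<omega>) \<partial>M) = 0"
    using V integrable_Re[OF Vk] fourier_zero_Re_Im(1)[OF V _ F F'] unfolding re
    by (intro *) auto
  moreover have "(\<integral>\<omega>. e \<omega> ^ k * Im (V \<omega>) \<partial>M) = 0"
    using V integrable_Im[OF Vk] fourier_zero_Re_Im(2)[OF V _ F F'] unfolding im
    by (intro *) auto
  ultimately have "(CLINT \<omega>|M. complex_of_real (e \<omega> ^ k) * V \<omega>) = 0"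
    using integral_Re[OF Vk] integral_Im[OF Vk] unfolding re im by (simp add: complex_eq_iff)
  moreover have "(CLINT \<omega>|M. complex_of_real (e \<omega> ^ k) * iexp (L \<omega>)) =
     (CLINT \<omega>|M. complex_of_real (e \<omega> ^ k) * V \<omega> + c * complex_of_real (e \<omega> ^ k))"
    by (intro Bochner_Integration.integral_cong refl) (simp add: V_def algebra_simps)
  moreover have "\<dots> = (CLINT \<omega>|M. complex_of_real (e \<omega> ^ k) * V \<omega>) +
      (CLINT \<omega>|M. c * complex_of_real (e \<omega> ^ k))"
    using k by (intro Bochner_Integration.integral_add Vk integrable_mult_right integrable_of_real)
  moreover have "(CLINT \<omega>|M. c * complex_of_real (e \<omega> ^ k)) = c * complex_of_real (\<integral>\<omega>. e \<omega> ^ k \<partial>M)"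
    by (simp only: integral_mult_right_zero integral_complex_of_real)
  ultimately show ?thesis by (simp add: c_def mult.commute)
qed

end

section \<open>Conditional variances of Gaussian processes\<close>

text \<open>
  The map \<open>s\<close> may repeat indices, in which case the coefficients over each fibre are added up;
  repeated observation times are covered in this way.
\<close>

lemma centered_gaussian_process_reindex:
  fixes s :: "'j \<Rightarrow> 'i"
  assumes G: "centered_gaussian_process M T Z" and s: "s ` J \<subseteq> T"
  shows "centered_gaussian_process M J (\<lambda>j. Z (s j))"
  unfolding centered_gaussian_process_def
proof (intro conjI allI impI)
  fix I and a :: "'j \<Rightarrow> real"
  assume I: "finite I \<and> I \<subseteq> J"
  have "(\<Sum>i\<in>I. a i * Z (s i) \<omega>) = (\<Sum>x\<in>s ` I. (\<Sum>i\<in>{i\<in>I. s i = x}. a i) * Z x \<omega>)" for \<omega>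
    using I by (subst sum.image_gen[of I _ s]) (auto simp: sum_distrib_right intro!: sum.cong)
  moreover have "gaussian_rv M (\<lambda>\<omega>. \<Sum>x\<in>s ` I. (\<Sum>i\<in>{i\<in>I. s i = x}. a i) * Z x \<omega>)"
  proof -
    have "finite (s ` I) \<and> s ` I \<subseteq> T" using I s by blast
    then show ?thesis
      by (rule G[unfolded centered_gaussian_process_def, THEN conjunct1, rule_format])
  qed
  ultimately show "gaussian_rv M (\<lambda>\<omega>. \<Sum>i\<in>I. a i * Z (s i) \<omega>)" by simp
qed (use G s in \<open>auto simp: centered_gaussian_process_def\<close>)

lemma (in prob_space) centered_gaussian_process_square_integrable:
  assumes G: "centered_gaussian_process M T Z" and t: "t \<in> T"
  shows "Z t \<in> square_integrable"
proof (rule gaussian_rv_centered(1))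
  have "gaussian_rv M (\<lambda>\<omega>. \<Sum>i\<in>{t}. 1 * Z i \<omega>)"
    by (rule G[unfolded centered_gaussian_process_def, THEN conjunct1, rule_format]) (use t in simp)
  then show "gaussian_rv M (Z t)" by simp
  show "(\<integral>\<omega>. Z t \<omega> \<partial>M) = 0" using G t by (simp add: centered_gaussian_process_def)
qed

text \<open>
  The moment identity above, applied with \<open>n = 1\<close> and \<open>n = 2\<close> to the orthogonal residual \<open>e\<close> and to
  all linear combinations of the observations, shows that \<open>e\<close> and \<open>e\<^sup>2 - v\<close>, with \<open>v = E (e\<^sup>2)\<close>,
  have conditional expectation zero. The first makes the projection \<open>p\<close> the conditional expectation
  of \<open>Y k\<close>, and the second makes \<open>v\<close> the conditional variance.
\<close>

lemma (in prob_space) cond_variance_gaussian: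
  assumes G: "centered_gaussian_process M (insert k I) Y" and I: "finite I" "k \<notin> I"
  obtains a where
    "AE \<omega> in M. cond_variance M (generated_by M I Y) (Y k) \<omega> =
       inner2 (\<lambda>\<omega>. Y k \<omega> - (\<Sum>i\<in>I. a i * Y i \<omega>)) (\<lambda>\<omega>. Y k \<omega> - (\<Sum>i\<in>I. a i * Y i \<omega>))"
proof -
  let ?F = "generated_by M I Y"
  have sq: "Y i \<in> square_integrable" if "i \<in> insert k I" for i
    using centered_gaussian_process_square_integrable[OF G that] .
  have sqI: "\<And>i. i \<in> I \<Longrightarrow> Y i \<in> square_integrable" and sqk: "Y k \<in> square_integrable"
    using sq by auto
  obtain a where a: "\<forall>i\<in>I. inner2 (\<lambda>\<omega>. Y k \<omega> - (\<Sum>i\<in>I. a i * Y i \<omega>)) (Y i) = 0"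
    using exists_orthogonal_residual[where Y = Y, OF I(1) sqI sqk] by blast
  define p where "p \<omega> = (\<Sum>i\<in>I. a i * Y i \<omega>)" for \<omega>
  define e where "e \<omega> = Y k \<omega> - p \<omega>" for \<omega>
  have p: "p \<in> square_integrable"
    unfolding p_def[abs_def] using sqI by (rule square_integrable_sum)
  have e: "e \<in> square_integrable"
    unfolding e_def[abs_def] using sqk p by (rule square_integrable_diff)
  have mean: "(\<integral>\<omega>. Y i \<omega> \<partial>M) = 0" if "i \<in> insert k I" for i
    using G that unfolding centered_gaussian_process_def by blast
  have meanL: "(\<integral>\<omega>. (\<Sum>i\<in>I. \<theta> i * Y i \<omega>) \<partial>M) = 0" for \<theta>
    using sqI mean by (subst Bochner_Integration.integral_sum)
      (auto intro!: integrable_mult_right square_integrable_imp_integrable)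
  have mean_e: "(\<integral>\<omega>. e \<omega> \<partial>M) = 0"
  proof -
    have "(\<integral>\<omega>. p \<omega> \<partial>M) = 0" unfolding p_def by (rule meanL)
    then show ?thesis
      using mean[of k] square_integrable_imp_integrable[OF sqk] square_integrable_imp_integrable[OF p]
      unfolding e_def by (subst Bochner_Integration.integral_diff) auto
  qed
  have moment: "(CLINT \<omega>|M. complex_of_real (e \<omega> ^ n) * iexp (\<Sum>i\<in>I. \<theta> i * Y i \<omega>)) =
     complex_of_real (\<integral>\<omega>. e \<omega> ^ n \<partial>M) * (CLINT \<omega>|M. iexp (\<Sum>i\<in>I. \<theta> i * Y i \<omega>))"
    if n: "integrable M (\<lambda>\<omega>. e \<omega> ^ n)" for n \<theta>
  proof (rule uncorrelated_gaussian_moment)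
    show "inner2 e (\<lambda>\<omega>. \<Sum>i\<in>I. \<theta> i * Y i \<omega>) = 0"
    proof -
      have "inner2 (Y i) e = 0" if "i \<in> I" for i
        using a that unfolding inner2_commute[of "Y i"] e_def p_def by blast
      then show ?thesis
        unfolding inner2_commute[of e] by (simp add: inner2_sum_left sqI e)
    qed
    fix \<tau> \<rho>
    let ?c = "\<lambda>i. if i = k then \<tau> else \<rho> * \<theta> i - \<tau> * a i"
    have "\<tau> * e \<omega> + \<rho> * (\<Sum>i\<in>I. \<theta> i * Y i \<omega>) = (\<Sum>i\<in>insert k I. ?c i * Y i \<omega>)" for \<omega>
    proof -
      have "(\<Sum>i\<in>I. ?c i * Y i \<omega>) = (\<Sum>i\<in>I. \<rho> * (\<theta> i * Y i \<omega>) - \<tau> * (a i * Y i \<omega>))"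
        using I by (intro sum.cong) (auto simp: algebra_simps)
      then show ?thesis
        using I by (simp add: e_def p_def sum_subtractf sum_distrib_left algebra_simps)
    qed
    moreover have "gaussian_rv M (\<lambda>\<omega>. \<Sum>i\<in>insert k I. ?c i * Y i \<omega>)"
      by (rule G[unfolded centered_gaussian_process_def, THEN conjunct1, rule_format]) (use I in simp)
    ultimately show "gaussian_rv M (\<lambda>\<omega>. \<tau> * e \<omega> + \<rho> * (\<Sum>i\<in>I. \<theta> i * Y i \<omega>))" by simp
  next
    show "(\<lambda>\<omega>. \<Sum>i\<in>I. \<theta> i * Y i \<omega>) \<in> square_integrable" using sqI by (rule square_integrable_sum)
  qed (fact mean_e meanL e n)+
  define v where "v = inner2 e e"
  have [measurable]: "e \<in> borel_measurable M" "p \<in> borel_measurable M" "Y k \<in> borel_measurable M"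
    using e p sqk by (auto intro: square_integrable_measurable)
  have measI[measurable]: "\<And>i. i \<in> I \<Longrightarrow> Y i \<in> borel_measurable M"
    using sqI by (auto intro: square_integrable_measurable)
  have e1: "integrable M e" using e by (rule square_integrable_imp_integrable)
  have e2: "integrable M (\<lambda>\<omega>. (e \<omega>)\<^sup>2)" using e by (simp add: square_integrable_def)
  interpret finite_measure_subalgebra M ?F
    by unfold_locales (rule subalgebra_generated_by[OF measI])
  have ce: "AE \<omega> in M. real_cond_exp M ?F e \<omega> = 0"
  proof (rule fourier_zero_imp_cond_exp_zero)
    show "(CLINT \<omega>|M. complex_of_real (e \<omega>) * iexp (\<Sum>i\<in>I. \<theta> i * Y i \<omega>)) = 0" for \<theta>
      using moment[of 1 \<theta>] e1 mean_e by simp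
  qed (fact I(1) measI e1)+
  have ce2: "AE \<omega> in M. real_cond_exp M ?F (\<lambda>\<omega>. (e \<omega>)\<^sup>2 - v) \<omega> = 0"
  proof (rule fourier_zero_imp_cond_exp_zero)
    show "integrable M (\<lambda>\<omega>. (e \<omega>)\<^sup>2 - v)" using e2 by simp
    fix \<theta>
    let ?L = "\<lambda>\<omega>. \<Sum>i\<in>I. \<theta> i * Y i \<omega>"
    have [measurable]: "?L \<in> borel_measurable M"
      using sqI by (intro square_integrable_measurable square_integrable_sum)
    have i1: "integrable M (\<lambda>\<omega>. complex_of_real ((e \<omega>)\<^sup>2) * iexp (?L \<omega>))"
      by (rule Bochner_Integration.integrable_bound[OF e2]) (auto simp: norm_mult norm_power)
    have i2: "integrable M (\<lambda>\<omega>. complex_of_real v * iexp (?L \<omega>))"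
      by (intro integrable_mult_right integrable_iexp) auto
    have "(CLINT \<omega>|M. complex_of_real ((e \<omega>)\<^sup>2 - v) * iexp (?L \<omega>)) =
       (CLINT \<omega>|M. complex_of_real ((e \<omega>)\<^sup>2) * iexp (?L \<omega>) - complex_of_real v * iexp (?L \<omega>))"
      by (simp only: of_real_diff left_diff_distrib)
    also have "\<dots> = (CLINT \<omega>|M. complex_of_real ((e \<omega>)\<^sup>2) * iexp (?L \<omega>)) - v * (CLINT \<omega>|M. iexp (?L \<omega>))"
      by (simp only: Bochner_Integration.integral_diff[OF i1 i2] integral_mult_right_zero)
    also have "\<dots> = 0"
      using moment[OF e2, of \<theta>] by (simp add: v_def inner2_def power2_eq_square)
    finally show "(CLINT \<omega>|M. complex_of_real ((e \<omega>)\<^sup>2 - v) * iexp (?L \<omega>)) = 0" .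
  qed (fact I(1) measI)+
  have pF: "p \<in> borel_measurable ?F"
    unfolding p_def[abs_def] using measurable_generated_by[of _ I Y M] by measurable
  have "AE \<omega> in M. real_cond_exp M ?F (\<lambda>\<omega>. p \<omega> + e \<omega>) \<omega> = real_cond_exp M ?F p \<omega> + real_cond_exp M ?F e \<omega>"
    by (rule real_cond_exp_add[OF square_integrable_imp_integrable[OF p] e1])
  moreover have "AE \<omega> in M. real_cond_exp M ?F p \<omega> = p \<omega>"
    by (rule real_cond_exp_F_meas[OF square_integrable_imp_integrable[OF p] pF])
  moreover have "(\<lambda>\<omega>. p \<omega> + e \<omega>) = Y k" by (auto simp: e_def)
  ultimately have "AE \<omega> in M. (Y k \<omega> - real_cond_exp M ?F (Y k) \<omega>)\<^sup>2 = ((e \<omega>)\<^sup>2 - v) + v"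
    using ce by (auto elim!: eventually_elim2 simp: e_def)
  then have "AE \<omega> in M. cond_variance M ?F (Y k) \<omega> = real_cond_exp M ?F (\<lambda>\<omega>. ((e \<omega>)\<^sup>2 - v) + v) \<omega>"
    unfolding cond_variance_def by (intro real_cond_exp_cong) measurable
  moreover have "AE \<omega> in M. real_cond_exp M ?F (\<lambda>\<omega>. ((e \<omega>)\<^sup>2 - v) + v) \<omega> =
      real_cond_exp M ?F (\<lambda>\<omega>. (e \<omega>)\<^sup>2 - v) \<omega> + real_cond_exp M ?F (\<lambda>\<omega>. v) \<omega>"
    using e2 by (intro real_cond_exp_add) auto
  moreover have "AE \<omega> in M. real_cond_exp M ?F (\<lambda>\<omega>. v) \<omega> = v"
    by (rule real_cond_exp_F_meas) auto
  ultimately have "AE \<omega> in M. cond_variance M ?F (Y k) \<omega> = v"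
    using ce2 by eventually_elim simp
  then show thesis
    by (intro that[of a]) (simp add: v_def e_def[abs_def] p_def)
qed

section \<open>The Fejer kernel\<close>

text \<open>
  Up to normalisation, the Fejer kernel of the real line. At \<open>0\<close> it has the value \<open>0\<close>, not the
  limit \<open>1 / 2\<close>, because of division by zero; only integrals of it matter.
\<close>

definition fejer :: "real \<Rightarrow> real" where
  "fejer x = (1 - cos x) / x\<^sup>2"

lemma borel_measurable_fejer[measurable]: "fejer \<in> borel_measurable borel"
  unfolding fejer_def[abs_def] by measurable

lemma fejer_nonneg: "0 \<le> fejer x"
  by (simp add: fejer_def)

lemma one_minus_cos_le: "1 - cos x \<le> (x::real)\<^sup>2 / 2"
proof -
  have "1 - cos x = 2 * (sin (x / 2))\<^sup>2"
    using cos_double_sin[of "x / 2"] by simp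
  also have "(sin (x / 2))\<^sup>2 \<le> (x / 2)\<^sup>2"
    using abs_sin_x_le_abs_x[of "x / 2"] by (simp only: abs_le_square_iff)
  finally show ?thesis by (simp add: power2_eq_square)
qed

lemma fejer_le: "fejer x \<le> 5 * (1 + \<bar>x\<bar>) powr (- 2)"
proof (cases "x = 0")
  case True
  then show ?thesis by (simp add: fejer_def)
next
  case False
  have "(1 + \<bar>x\<bar>)\<^sup>2 \<le> 2 + 2 * x\<^sup>2"
    using sum_squares_bound[of 1 "\<bar>x\<bar>"] by (simp add: power2_eq_square algebra_simps)
  then have "(1 - cos x) * (1 + \<bar>x\<bar>)\<^sup>2 \<le> (1 - cos x) * (2 + 2 * x\<^sup>2)"
    by (rule mult_left_mono) simp
  also have "\<dots> = 2 * (1 - cos x) + 2 * (1 - cos x) * x\<^sup>2"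
    by (simp add: algebra_simps)
  also have "\<dots> \<le> 2 * (x\<^sup>2 / 2) + 4 * x\<^sup>2"
  proof (intro add_mono mult_left_mono mult_right_mono)
    show "2 * (1 - cos x) \<le> 4" by (smt (verit) cos_ge_minus_one)
  qed (use one_minus_cos_le[of x] in auto)
  finally have "(1 - cos x) * (1 + \<bar>x\<bar>)\<^sup>2 \<le> 5 * x\<^sup>2" by simp
  moreover have "0 < (1 + \<bar>x\<bar>)\<^sup>2" by (simp add: add_pos_nonneg)
  ultimately have "fejer x \<le> 5 / (1 + \<bar>x\<bar>)\<^sup>2"
    using False by (simp add: fejer_def field_simps)
  then show ?thesis
    by (simp add: powr_minus_divide)
qed

lemma integrable_one_plus_abs_powr:
  assumes p: "1 < p"
  shows "integrable lborel (\<lambda>x::real. (1 + \<bar>x\<bar>) powr (- p))"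
proof -
  let ?f = "\<lambda>x::real. (1 + \<bar>x\<bar>) powr (- p)"
  let ?F = "\<lambda>x::real. (1 + x) powr (1 - p) / (1 - p)"
  have "(\<integral>\<^sup>+x. ennreal (?f x) * indicator {0..} x \<partial>lborel) = ennreal (0 - ?F 0)"
  proof (rule nn_integral_FTC_atLeast)
    show "DERIV ?F x :> ?f x" if "0 \<le> x" for x
    proof -
      have "DERIV (\<lambda>x. (1 + x) powr (1 - p)) x :> (1 - p) * (1 + x) powr (- p)"
        using DERIV_fun_powr[of "\<lambda>x. 1 + x" 1 x "1 - p"] that by (auto intro!: derivative_eq_intros)
      from DERIV_cdivide[OF this, of "1 - p"] that p show ?thesis by simp
    qed
    have "((\<lambda>x. (1 + x) powr (1 - p)) \<longlongrightarrow> 0) at_top"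
      using p by (intro tendsto_neg_powr filterlim_tendsto_add_at_top[OF tendsto_const]
          filterlim_ident) auto
    from tendsto_divide[OF this tendsto_const, of "1 - p"] p
    show "(?F \<longlongrightarrow> 0) at_top" by simp
  qed auto
  moreover have "(\<integral>\<^sup>+x. ennreal (?f x) * indicator {0..} x \<partial>lborel) =
      (\<integral>\<^sup>+x. ennreal (norm (indicator {0..} x *\<^sub>R ?f x)) \<partial>lborel)"
    by (intro nn_integral_cong) (auto split: split_indicator)
  ultimately have "integrable lborel (\<lambda>x. indicator {0..} x *\<^sub>R ?f x)"
    by (intro integrableI_bounded) auto
  then have "has_bochner_integral lborel (\<lambda>x. indicator {0..} x *\<^sub>R ?f x)
      (LINT x|lborel. indicator {0..} x *\<^sub>R ?f x)"
    by (rule has_bochner_integral_integrable)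
  from has_bochner_integral_even_function[OF this] show ?thesis
    by (auto intro: integrable.intros)
qed

lemma integrable_fejer: "integrable lborel fejer"
  by (rule Bochner_Integration.integrable_bound
        [OF integrable_mult_right[OF integrable_one_plus_abs_powr[of 2], of 5]])
    (use fejer_le in \<open>auto simp: fejer_nonneg\<close>)

lemma integral_fejer_pos: "0 < (LINT x|lborel. fejer x)"
proof -
  have "(LINT x|lborel. fejer x) \<noteq> 0"
  proof
    assume "(LINT x|lborel. fejer x) = 0"
    then have "AE x in lborel. fejer x = 0"
      using integral_nonneg_eq_0_iff_AE[OF integrable_fejer] fejer_nonneg by auto
    moreover have "fejer x \<noteq> 0" if "x \<in> {1<..<2}" for x
    proof -
      have "cos x < cos 0" using that pi_gt3 by (intro cos_monotone_0_pi) auto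
      then show ?thesis using that by (auto simp: fejer_def)
    qed
    ultimately have "AE x in lborel. x \<notin> {1<..<(2::real)}" by (auto elim: eventually_mono)
    then have "{1<..<(2::real)} \<in> null_sets lborel"
      by (subst AE_iff_null_sets) auto
    then show False by (auto simp: null_sets_def)
  qed
  moreover have "0 \<le> (LINT x|lborel. fejer x)" by (simp add: fejer_nonneg)
  ultimately show ?thesis by simp
qed

text \<open>
  Substituting \<open>a * x\<close> for \<open>x\<close> turns the Fejer kernel into this integrand, up to a power of \<open>a\<close>.
\<close>

lemma fejer_scaled:
  "has_bochner_integral lborel (\<lambda>x. (1 - cos (a * x)) / x\<^sup>2) (\<bar>a\<bar> * (LINT x|lborel. fejer x))"
proof (cases "a = 0")
  case True
  then show ?thesis by (simp add: has_bochner_integral_zero)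
next
  case False
  have "has_bochner_integral lborel (\<lambda>x. fejer (0 + a * x)) ((LINT x|lborel. fejer x) /\<^sub>R \<bar>a\<bar>)"
    using lborel_has_bochner_integral_real_affine_iff[OF False, of fejer _ 0]
      has_bochner_integral_integrable[OF integrable_fejer] by blast
  from has_bochner_integral_mult_right[OF this, of "a\<^sup>2"]
  have 1: "has_bochner_integral lborel (\<lambda>x. a\<^sup>2 * fejer (0 + a * x))
      (a\<^sup>2 * ((LINT x|lborel. fejer x) /\<^sub>R \<bar>a\<bar>))" by simp
  have 2: "a\<^sup>2 * fejer (0 + a * x) = (1 - cos (a * x)) / x\<^sup>2" for x
    using False by (simp add: fejer_def power_mult_distrib)
  have 3: "a\<^sup>2 * ((LINT x|lborel. fejer x) /\<^sub>R \<bar>a\<bar>) = \<bar>a\<bar> * (LINT x|lborel. fejer x)"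
    using False by (simp add: divide_simps power2_eq_square)
  from 1[unfolded 2 3] show ?thesis .
qed

text \<open>
  A product formula for cosines expresses the integrand as a second difference of the integrands of
  \<open>fejer_scaled\<close> in the parameter \<open>a\<close>, so the result is the second difference of \<open>\<bar>u\<bar>\<close>, a tent that
  vanishes for \<open>\<bar>u\<bar> \<ge> 1\<close>.
\<close>

lemma fejer_cos:
  "has_bochner_integral lborel (\<lambda>x. fejer x * cos (u * x))
     ((\<bar>u + 1\<bar> + \<bar>u - 1\<bar> - 2 * \<bar>u\<bar>) / 2 * (LINT x|lborel. fejer x))"
proof -
  let ?g = "\<lambda>a x::real. (1 - cos (a * x)) / x\<^sup>2"
  let ?D = "LINT x|lborel. fejer x"
  have 1: "has_bochner_integral lborel (\<lambda>x. (?g (u + 1) x + ?g (u - 1) x) / 2 - ?g u x)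
     ((\<bar>u + 1\<bar> * ?D + \<bar>u - 1\<bar> * ?D) / 2 - \<bar>u\<bar> * ?D)"
    by (intro has_bochner_integral_diff has_bochner_integral_divide_zero has_bochner_integral_add
         fejer_scaled)
  have 2: "(?g (u + 1) x + ?g (u - 1) x) / 2 - ?g u x = fejer x * cos (u * x)" for x
  proof -
    have "cos ((u + 1) * x) + cos ((u - 1) * x) = 2 * cos (u * x) * cos x"
      by (simp add: distrib_right left_diff_distrib cos_add cos_diff)
    moreover have "(1 - a + (1 - b)) / 2 - (1 - c) = c - (a + b) / 2" for a b c :: real
      by (simp add: field_simps)
    ultimately have "(1 - cos ((u + 1) * x) + (1 - cos ((u - 1) * x))) / 2 - (1 - cos (u * x)) =
        cos (u * x) - 2 * cos (u * x) * cos x / 2" by (simp only:)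
    then have "(1 - cos ((u + 1) * x) + (1 - cos ((u - 1) * x))) / 2 - (1 - cos (u * x)) =
        (1 - cos x) * cos (u * x)" by (simp only: left_diff_distrib) simp
    then show ?thesis
      unfolding fejer_def by (simp flip: add_divide_distrib diff_divide_distrib) (simp add: divide_simps)
  qed
  have 3: "(\<bar>u + 1\<bar> * ?D + \<bar>u - 1\<bar> * ?D) / 2 - \<bar>u\<bar> * ?D =
      (\<bar>u + 1\<bar> + \<bar>u - 1\<bar> - 2 * \<bar>u\<bar>) / 2 * ?D"
    by (simp add: field_simps)
  from 1[unfolded 2 3] show ?thesis .
qed

lemma fejer_dilated_cos:
  assumes "0 < \<epsilon>"
  shows "has_bochner_integral lborel (\<lambda>x. fejer (\<epsilon> * x) * cos (u * x))
     ((\<bar>u + \<epsilon>\<bar> + \<bar>u - \<epsilon>\<bar> - 2 * \<bar>u\<bar>) / (2 * \<epsilon>\<^sup>2) * (LINT x|lborel. fejer x))"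
proof -
  let ?D = "LINT x|lborel. fejer x"
  have e: "\<epsilon> \<noteq> 0" using assms by simp
  have 1: "has_bochner_integral lborel (\<lambda>x. fejer (0 + \<epsilon> * x) * cos (u / \<epsilon> * (0 + \<epsilon> * x)))
     (((\<bar>u / \<epsilon> + 1\<bar> + \<bar>u / \<epsilon> - 1\<bar> - 2 * \<bar>u / \<epsilon>\<bar>) / 2 * ?D) /\<^sub>R \<bar>\<epsilon>\<bar>)"
    using lborel_has_bochner_integral_real_affine_iff[OF e, of "\<lambda>x. fejer x * cos (u / \<epsilon> * x)" _ 0]
      fejer_cos[of "u / \<epsilon>"] by blast
  have "\<bar>u / \<epsilon> + 1\<bar> = \<bar>u + \<epsilon>\<bar> / \<epsilon>" "\<bar>u / \<epsilon> - 1\<bar> = \<bar>u - \<epsilon>\<bar> / \<epsilon>" "\<bar>u / \<epsilon>\<bar> = \<bar>u\<bar> / \<epsilon>"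
    using assms by (auto simp: abs_if field_simps)
  then have 2: "((\<bar>u / \<epsilon> + 1\<bar> + \<bar>u / \<epsilon> - 1\<bar> - 2 * \<bar>u / \<epsilon>\<bar>) / 2 * ?D) /\<^sub>R \<bar>\<epsilon>\<bar> =
     (\<bar>u + \<epsilon>\<bar> + \<bar>u - \<epsilon>\<bar> - 2 * \<bar>u\<bar>) / (2 * \<epsilon>\<^sup>2) * ?D"
    using assms by (simp add: field_simps power2_eq_square)
  from 1[unfolded 2] show ?thesis using assms by simp
qed

section \<open>An extremal problem for trigonometric sums\<close>

text \<open>
  With \<open>\<psi> l = fejer (\<epsilon> * l)\<close>, the integral of \<open>B * \<psi>\<close> is \<open>b j\<^sub>0 * D / \<epsilon>\<close>, since the frequencies
  other than \<open>u j\<^sub>0 = 0\<close> lie outside the support of the tent. Integrating the pointwise inequality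
  \<open>2 * \<theta> * B * \<psi> - \<theta>\<^sup>2 * \<psi>\<^sup>2 / w \<le> B\<^sup>2 * w\<close> with the best constant \<open>\<theta>\<close> amounts to the Cauchy-Schwarz
  inequality. The kernel decays like the inverse square, so \<open>\<psi>\<^sup>2 / w\<close> is integrable exactly
  because \<open>H < 1\<close>.
\<close>

lemma weighted_energy_lower_bound:
  fixes H :: real
  assumes H: "0 < H" "H < 1"
  obtains \<kappa> where "0 < \<kappa>"
    "\<And>(J :: 'i set) u b j\<^sub>0 \<epsilon>. finite J \<Longrightarrow> j\<^sub>0 \<in> J \<Longrightarrow> u j\<^sub>0 = 0 \<Longrightarrow> 0 < \<epsilon> \<Longrightarrow> \<epsilon> \<le> 1 \<Longrightarrow>
        (\<And>j. j \<in> J - {j\<^sub>0} \<Longrightarrow> \<epsilon> \<le> \<bar>u j\<bar>) \<Longrightarrow>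
        integrable lborel (\<lambda>l. (\<Sum>j\<in>J. b j * cos (u j * l))\<^sup>2 * (1 + \<bar>l\<bar>) powr (- (1 + 2 * H))) \<and>
        \<kappa> * (b j\<^sub>0)\<^sup>2 * \<epsilon> powr (2 * H) \<le>
          (LINT l|lborel. (\<Sum>j\<in>J. b j * cos (u j * l))\<^sup>2 * (1 + \<bar>l\<bar>) powr (- (1 + 2 * H)))"
proof -
  define D where "D = (LINT x|lborel. fejer x)"
  define h where "h x = (fejer x)\<^sup>2 * (1 + \<bar>x\<bar>) powr (1 + 2 * H)" for x
  \<comment> \<open>The summand \<open>1\<close> makes \<open>E\<close> positive, so that it may be divided by.\<close>
  define E where "E = (LINT x|lborel. h x) + 1"
  have D: "0 < D" unfolding D_def by (rule integral_fejer_pos)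
  have h0: "0 \<le> h x" for x by (simp add: h_def)
  have h_le: "h x \<le> 25 * (1 + \<bar>x\<bar>) powr (- (3 - 2 * H))" for x
  proof -
    have "(fejer x)\<^sup>2 \<le> (5 * (1 + \<bar>x\<bar>) powr (- 2))\<^sup>2"
      by (rule power_mono[OF fejer_le fejer_nonneg])
    also have "\<dots> = 25 * (1 + \<bar>x\<bar>) powr (- 4)"
      by (simp add: power2_eq_square flip: powr_add)
    finally have "h x \<le> 25 * (1 + \<bar>x\<bar>) powr (- 4) * (1 + \<bar>x\<bar>) powr (1 + 2 * H)"
      unfolding h_def by (rule mult_right_mono) simp
    also have "\<dots> = 25 * (1 + \<bar>x\<bar>) powr (- (3 - 2 * H))"
      by (simp add: mult.assoc flip: powr_add)
    finally show ?thesis .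
  qed
  have h_int: "integrable lborel h"
  proof (rule Bochner_Integration.integrable_bound)
    show "integrable lborel (\<lambda>x::real. 25 * (1 + \<bar>x\<bar>) powr (- (3 - 2 * H)))"
      using H by (intro integrable_mult_right integrable_one_plus_abs_powr) auto
    show "h \<in> borel_measurable lborel" unfolding h_def[abs_def] by simp
    show "AE x in lborel. norm (h x) \<le> norm (25 * (1 + \<bar>x\<bar>) powr (- (3 - 2 * H)))"
      using h_le h0 by (intro always_eventually) simp
  qed
  have "0 \<le> (LINT x|lborel. h x)" by (simp add: h0)
  then have E: "0 < E" unfolding E_def by linarith
  show thesis
  proof (rule that[of "D\<^sup>2 / E"])
    show "0 < D\<^sup>2 / E" using D E by simp
    fix J :: "'i set" and u b j\<^sub>0 and \<epsilon> :: real
    assume J: "finite J" "j\<^sub>0 \<in> J" and u0: "u j\<^sub>0 = 0" and eps: "0 < \<epsilon>" "\<epsilon> \<le> 1"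
      and sep: "\<And>j. j \<in> J - {j\<^sub>0} \<Longrightarrow> \<epsilon> \<le> \<bar>u j\<bar>"
    define B where "B l = (\<Sum>j\<in>J. b j * cos (u j * l))" for l
    define w where "w l = (1 + \<bar>l\<bar>) powr (- (1 + 2 * H))" for l :: real
    have w: "0 < w l" for l unfolding w_def by (simp add: add_pos_nonneg)
    have [measurable]: "B \<in> borel_measurable borel" "w \<in> borel_measurable borel"
      unfolding B_def[abs_def] w_def[abs_def] by simp_all
    have B_le: "\<bar>B l\<bar> \<le> (\<Sum>j\<in>J. \<bar>b j\<bar>)" for l
      unfolding B_def
      by (rule order.trans[OF sum_abs]) (intro sum_mono, simp add: abs_mult mult_left_le)
    have int: "integrable lborel (\<lambda>l. (B l)\<^sup>2 * w l)"
    proof (rule Bochner_Integration.integrable_bound)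
      show "integrable lborel (\<lambda>l. (\<Sum>j\<in>J. \<bar>b j\<bar>)\<^sup>2 * w l)"
        unfolding w_def[abs_def] using H
        by (intro integrable_mult_right integrable_one_plus_abs_powr) simp
      have "(B l)\<^sup>2 \<le> (\<Sum>j\<in>J. \<bar>b j\<bar>)\<^sup>2" for l
        using B_le[of l] by (simp add: abs_le_square_iff[symmetric])
      then show "AE l in lborel. norm ((B l)\<^sup>2 * w l) \<le> norm ((\<Sum>j\<in>J. \<bar>b j\<bar>)\<^sup>2 * w l)"
        using w by (intro always_eventually) (auto simp: abs_mult less_imp_le)
    qed simp
    have "has_bochner_integral lborel (\<lambda>l. \<Sum>j\<in>J. b j * (fejer (\<epsilon> * l) * cos (u j * l)))
       (\<Sum>j\<in>J. b j * ((\<bar>u j + \<epsilon>\<bar> + \<bar>u j - \<epsilon>\<bar> - 2 * \<bar>u j\<bar>) / (2 * \<epsilon>\<^sup>2) * D))"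
      unfolding D_def using fejer_dilated_cos[OF eps(1)]
      by (intro has_bochner_integral_sum has_bochner_integral_mult_right) auto
    moreover have "(\<Sum>j\<in>J. b j * ((\<bar>u j + \<epsilon>\<bar> + \<bar>u j - \<epsilon>\<bar> - 2 * \<bar>u j\<bar>) / (2 * \<epsilon>\<^sup>2) * D)) = b j\<^sub>0 * D / \<epsilon>"
    proof -
      have "(\<Sum>j\<in>J. b j * ((\<bar>u j + \<epsilon>\<bar> + \<bar>u j - \<epsilon>\<bar> - 2 * \<bar>u j\<bar>) / (2 * \<epsilon>\<^sup>2) * D)) =
        (\<Sum>j\<in>{j\<^sub>0}. b j * ((\<bar>u j + \<epsilon>\<bar> + \<bar>u j - \<epsilon>\<bar> - 2 * \<bar>u j\<bar>) / (2 * \<epsilon>\<^sup>2) * D))"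
      proof (rule sum.mono_neutral_right)
        show "\<forall>j\<in>J - {j\<^sub>0}. b j * ((\<bar>u j + \<epsilon>\<bar> + \<bar>u j - \<epsilon>\<bar> - 2 * \<bar>u j\<bar>) / (2 * \<epsilon>\<^sup>2) * D) = 0"
        proof
          fix j assume "j \<in> J - {j\<^sub>0}"
          from sep[OF this] eps(1) have "\<bar>u j + \<epsilon>\<bar> + \<bar>u j - \<epsilon>\<bar> - 2 * \<bar>u j\<bar> = 0" by linarith
          then show "b j * ((\<bar>u j + \<epsilon>\<bar> + \<bar>u j - \<epsilon>\<bar> - 2 * \<bar>u j\<bar>) / (2 * \<epsilon>\<^sup>2) * D) = 0" by simp
        qed
      qed (use J in auto)
      also have "\<dots> = b j\<^sub>0 * D / \<epsilon>"
        using u0 eps by (simp add: power2_eq_square)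
      finally show ?thesis .
    qed
    moreover have "(\<Sum>j\<in>J. b j * (fejer (\<epsilon> * l) * cos (u j * l))) = B l * fejer (\<epsilon> * l)" for l
      unfolding B_def sum_distrib_right by (simp add: mult_ac)
    ultimately have BF: "has_bochner_integral lborel (\<lambda>l. B l * fejer (\<epsilon> * l)) (b j\<^sub>0 * D / \<epsilon>)"
      by simp
    \<comment> \<open>This maximises \<open>2 * \<theta> * (b j\<^sub>0 * D / \<epsilon>) - \<theta>\<^sup>2 * E * \<epsilon> powr (- (2 + 2 * H))\<close>.\<close>
    define \<theta> where "\<theta> = b j\<^sub>0 * D * \<epsilon> powr (1 + 2 * H) / E"
    have hs: "has_bochner_integral lborel (\<lambda>l. h (0 + \<epsilon> * l)) ((E - 1) /\<^sub>R \<bar>\<epsilon>\<bar>)"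
      using lborel_has_bochner_integral_real_affine_iff[of \<epsilon> h "E - 1" 0] eps
        has_bochner_integral_integrable[OF h_int] by (simp add: E_def)
    have low: "2 * \<theta> * (B l * fejer (\<epsilon> * l)) - \<theta>\<^sup>2 * \<epsilon> powr (- (1 + 2 * H)) * h (0 + \<epsilon> * l) \<le> (B l)\<^sup>2 * w l" for l
    proof -
      have "1 / w l = (1 + \<bar>l\<bar>) powr (1 + 2 * H)"
        unfolding w_def powr_minus_divide by simp
      also have "\<dots> \<le> ((1 + \<bar>\<epsilon> * l\<bar>) / \<epsilon>) powr (1 + 2 * H)"
        using eps H by (intro powr_mono2) (auto simp: abs_mult field_simps)
      also have "\<dots> = \<epsilon> powr (- (1 + 2 * H)) * (1 + \<bar>\<epsilon> * l\<bar>) powr (1 + 2 * H)"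
        using eps unfolding powr_minus_divide by (simp add: powr_divide)
      finally have "(fejer (\<epsilon> * l))\<^sup>2 * (1 / w l) \<le>
          (fejer (\<epsilon> * l))\<^sup>2 * (\<epsilon> powr (- (1 + 2 * H)) * (1 + \<bar>\<epsilon> * l\<bar>) powr (1 + 2 * H))"
        by (rule mult_left_mono) simp
      then have "(fejer (\<epsilon> * l))\<^sup>2 / w l \<le> \<epsilon> powr (- (1 + 2 * H)) * h (0 + \<epsilon> * l)"
        by (simp add: h_def mult_ac)
      then have "\<theta>\<^sup>2 * ((fejer (\<epsilon> * l))\<^sup>2 / w l) \<le> \<theta>\<^sup>2 * (\<epsilon> powr (- (1 + 2 * H)) * h (0 + \<epsilon> * l))"
        by (rule mult_left_mono) simp
      moreover have "0 \<le> (B l * w l - \<theta> * fejer (\<epsilon> * l))\<^sup>2 / w l"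
        using w[of l] by simp
      moreover have "(B l * w l - \<theta> * fejer (\<epsilon> * l))\<^sup>2 / w l =
          (B l)\<^sup>2 * w l - 2 * \<theta> * (B l * fejer (\<epsilon> * l)) + \<theta>\<^sup>2 * ((fejer (\<epsilon> * l))\<^sup>2 / w l)"
        using w[of l] by (simp add: power2_eq_square field_simps)
      ultimately show ?thesis by (simp only: mult.assoc)
    qed
    have "has_bochner_integral lborel
        (\<lambda>l. 2 * \<theta> * (B l * fejer (\<epsilon> * l)) - \<theta>\<^sup>2 * \<epsilon> powr (- (1 + 2 * H)) * h (0 + \<epsilon> * l))
        (2 * \<theta> * (b j\<^sub>0 * D / \<epsilon>) - \<theta>\<^sup>2 * \<epsilon> powr (- (1 + 2 * H)) * ((E - 1) /\<^sub>R \<bar>\<epsilon>\<bar>))"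
      by (intro has_bochner_integral_diff has_bochner_integral_mult_right BF hs)
    then have "2 * \<theta> * (b j\<^sub>0 * D / \<epsilon>) - \<theta>\<^sup>2 * \<epsilon> powr (- (1 + 2 * H)) * ((E - 1) /\<^sub>R \<bar>\<epsilon>\<bar>)
        \<le> (LINT l|lborel. (B l)\<^sup>2 * w l)"
      using integral_mono[OF _ int low] by (simp add: has_bochner_integral_iff)
    moreover have "D\<^sup>2 / E * (b j\<^sub>0)\<^sup>2 * \<epsilon> powr (2 * H) \<le>
        2 * \<theta> * (b j\<^sub>0 * D / \<epsilon>) - \<theta>\<^sup>2 * \<epsilon> powr (- (1 + 2 * H)) * ((E - 1) /\<^sub>R \<bar>\<epsilon>\<bar>)"
    proof -
      define p where "p = \<epsilon> powr (2 * H)"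
      have p: "\<epsilon> powr (1 + 2 * H) = \<epsilon> * p" "\<epsilon> powr (- (1 + 2 * H)) = 1 / (\<epsilon> * p)" "0 < p"
        using eps unfolding p_def powr_minus_divide by (simp_all add: powr_add)
      have "2 * \<theta> * (b j\<^sub>0 * D / \<epsilon>) - \<theta>\<^sup>2 * \<epsilon> powr (- (1 + 2 * H)) * ((E - 1) /\<^sub>R \<bar>\<epsilon>\<bar>) -
         D\<^sup>2 / E * (b j\<^sub>0)\<^sup>2 * \<epsilon> powr (2 * H) = (b j\<^sub>0)\<^sup>2 * D\<^sup>2 * p / E\<^sup>2"
        unfolding \<theta>_def p p_def[symmetric] using eps E p(3)
        by (simp add: field_simps power2_eq_square)
      moreover have "0 \<le> (b j\<^sub>0)\<^sup>2 * D\<^sup>2 * p / E\<^sup>2" using p(3) by simp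
      ultimately show ?thesis by linarith
    qed
    ultimately have "D\<^sup>2 / E * (b j\<^sub>0)\<^sup>2 * \<epsilon> powr (2 * H) \<le> (LINT l|lborel. (B l)\<^sup>2 * w l)"
      by (rule order.trans[rotated])
    with int show "integrable lborel (\<lambda>l. (\<Sum>j\<in>J. b j * cos (u j * l))\<^sup>2 * (1 + \<bar>l\<bar>) powr (- (1 + 2 * H))) \<and>
        D\<^sup>2 / E * (b j\<^sub>0)\<^sup>2 * \<epsilon> powr (2 * H) \<le>
          (LINT l|lborel. (\<Sum>j\<in>J. b j * cos (u j * l))\<^sup>2 * (1 + \<bar>l\<bar>) powr (- (1 + 2 * H)))"
      unfolding B_def w_def by blast
  qed
qed

section \<open>Quadratic forms and their spectral integrals\<close>

lemma std_normal_cos_transform: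
  "(LINT x|lborel. std_normal_density x * cos (t * x)) = sqrt (2 * pi) * std_normal_density t"
proof -
  have i: "integrable lborel (\<lambda>x. std_normal_density x *\<^sub>R iexp (t * x))"
    by (rule Bochner_Integration.integrable_bound[OF integrable_normal_density[of 1 0]]) auto
  have "complex_of_real (exp (- (t^2) / 2)) = (CLINT x|lborel. std_normal_density x *\<^sub>R iexp (t * x))"
    using char_std_normal_distribution[THEN fun_cong, of t]
    unfolding char_def by (subst (asm) integral_density) auto
  then have "exp (- (t^2) / 2) = (LINT x|lborel. Re (std_normal_density x *\<^sub>R iexp (t * x)))"
    by (subst integral_Re[OF i]) (metis Re_complex_of_real)
  then have "exp (- (t^2) / 2) = (LINT x|lborel. std_normal_density x * cos (t * x))"
    by (simp add: Re_exp)
  then show ?thesis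
    by (simp only: std_normal_density_def[of t]) simp
qed

lemma std_normal_density_le_at_0: "std_normal_density x \<le> std_normal_density 0"
  by (simp add: std_normal_density_def divide_right_mono)

text \<open>
  A one-sided Fourier inversion formula. Since \<open>Q\<close> is largest at \<open>0\<close>, any average of \<open>Q\<close> is at most
  \<open>Q 0\<close>; for Gaussian averages of width \<open>1 / n\<close> Fubini rewrites the average as an integral of the
  cosine transform against a Gaussian of width \<open>n\<close>. Replacing the transform by its integrable
  minorant \<open>f\<close> allows passing to the limit by dominated convergence.
\<close>

lemma integral_cos_transform_le_value_at_max:
  fixes Q f :: "real \<Rightarrow> real"
  assumes Q: "integrable lborel Q" and max: "\<And>v. Q v \<le> Q 0"
    and f: "integrable lborel f" "\<And>l. f l \<le> (LINT v|lborel. Q v * cos (l * v))"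
  shows "(LINT l|lborel. f l) \<le> 2 * pi * Q 0"
proof -
  let ?n = std_normal_density
  have [measurable]: "Q \<in> borel_measurable borel" "f \<in> borel_measurable borel"
    using Q f by auto
  define g where "g l = (LINT v|lborel. Q v * cos (l * v))" for l
  have step: "(LINT l|lborel. ?n (l / real (Suc k)) * f l) \<le> sqrt (2 * pi) * Q 0" for k
  proof -
    define n where "n = real (Suc k)"
    have n: "0 < n" by (simp add: n_def)
    have i1: "integrable lborel (\<lambda>l. ?n (l / n))"
      using lborel_integrable_real_affine[of ?n "1 / n" 0] n by simp
    have i2: "integrable lborel (\<lambda>v. ?n (n * v))"
      using lborel_integrable_real_affine[of ?n n 0] n by simp
    have ip: "integrable (lborel \<Otimes>\<^sub>M lborel) (\<lambda>(l, v). ?n (l / n) * Q v)"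
    proof (rule lborel_pair.Fubini_integrable)
      show "integrable lborel (\<lambda>l. LINT v|lborel. norm (case (l, v) of (l, v) \<Rightarrow> ?n (l / n) * Q v))"
        using i1 by (simp add: abs_mult)
      show "AE l in lborel. integrable lborel (\<lambda>v. case (l, v) of (l, v) \<Rightarrow> ?n (l / n) * Q v)"
        using Q by simp
    qed measurable
    have ic: "integrable (lborel \<Otimes>\<^sub>M lborel) (\<lambda>(l, v). ?n (l / n) * (Q v * cos (l * v)))"
      by (rule Bochner_Integration.integrable_bound[OF ip])
        (auto simp: abs_mult intro!: always_eventually mult_left_mono mult_left_le)
    have ig: "integrable lborel (\<lambda>l. ?n (l / n) * g l)"
      using lborel_pair.integrable_fst'[OF ic] by (simp add: g_def)
    have "(LINT l|lborel. ?n (l / n) * f l) \<le> (LINT l|lborel. ?n (l / n) * g l)"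
    proof (rule integral_mono[OF _ ig])
      show "integrable lborel (\<lambda>l. ?n (l / n) * f l)"
      proof (rule Bochner_Integration.integrable_bound[OF integrable_mult_right[OF f(1), of "?n 0"]])
        show "AE l in lborel. norm (?n (l / n) * f l) \<le> norm (?n 0 * f l)"
          by (intro always_eventually) (auto simp: abs_mult std_normal_density_le_at_0 intro!: mult_right_mono)
      qed measurable
      show "?n (l / n) * f l \<le> ?n (l / n) * g l" for l
        using f(2) by (auto simp: g_def intro!: mult_left_mono)
    qed
    also have "\<dots> = (LINT l|lborel. LINT v|lborel. ?n (l / n) * (Q v * cos (l * v)))"
      by (simp add: g_def)
    also have "\<dots> = (LINT v|lborel. LINT l|lborel. ?n (l / n) * (Q v * cos (l * v)))"
      using lborel_pair.Fubini_integral[OF ic] by simp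
    also have "\<dots> = (LINT v|lborel. Q v * (n * sqrt (2 * pi) * ?n (n * v)))"
    proof (intro Bochner_Integration.integral_cong refl)
      fix v
      have "(LINT l|lborel. ?n (l / n) * cos (l * v)) = n * (LINT x|lborel. ?n x * cos (n * v * x))"
        using lborel_integral_real_affine[of n "\<lambda>l. ?n (l / n) * cos (l * v)" 0] n
        by (simp add: mult_ac)
      then have "(LINT l|lborel. ?n (l / n) * cos (l * v)) = n * sqrt (2 * pi) * ?n (n * v)"
        by (simp add: std_normal_cos_transform)
      moreover have "(LINT l|lborel. ?n (l / n) * (Q v * cos (l * v))) =
          (LINT l|lborel. Q v * (?n (l / n) * cos (l * v)))" by (simp add: mult_ac)
      ultimately show "(LINT l|lborel. ?n (l / n) * (Q v * cos (l * v))) = Q v * (n * sqrt (2 * pi) * ?n (n * v))"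
        by simp
    qed
    also have "\<dots> \<le> (LINT v|lborel. Q 0 * (n * sqrt (2 * pi) * ?n (n * v)))"
    proof (rule integral_mono)
      show "integrable lborel (\<lambda>v. Q v * (n * sqrt (2 * pi) * ?n (n * v)))"
      proof (rule Bochner_Integration.integrable_bound[OF integrable_mult_left[OF Q, of "n * sqrt (2 * pi) * ?n 0"]])
        show "AE v in lborel. norm (Q v * (n * sqrt (2 * pi) * ?n (n * v))) \<le> norm (Q v * (n * sqrt (2 * pi) * ?n 0))"
          using n by (intro always_eventually) (auto simp: abs_mult std_normal_density_le_at_0 intro!: mult_left_mono)
      qed measurable
      show "integrable lborel (\<lambda>v. Q 0 * (n * sqrt (2 * pi) * ?n (n * v)))"
        using i2 by simp
      show "Q v * (n * sqrt (2 * pi) * ?n (n * v)) \<le> Q 0 * (n * sqrt (2 * pi) * ?n (n * v))" for v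
        using max n by (intro mult_right_mono) auto
    qed
    also have "\<dots> = sqrt (2 * pi) * Q 0"
      using lborel_integral_real_affine[of n ?n 0] n by simp
    finally show ?thesis by (simp add: n_def)
  qed
  have "(\<lambda>k. LINT l|lborel. ?n (l / real (Suc k)) * f l) \<longlonglongrightarrow> (LINT l|lborel. ?n 0 * f l)"
  proof (rule integral_dominated_convergence)
    show "integrable lborel (\<lambda>l. ?n 0 * \<bar>f l\<bar>)" using f by simp
    show "AE l in lborel. (\<lambda>k. ?n (l / real (Suc k)) * f l) \<longlonglongrightarrow> ?n 0 * f l"
    proof (intro always_eventually allI tendsto_intros)
      fix l :: real
      have "(\<lambda>k. l / real (Suc k)) \<longlonglongrightarrow> 0"
        using LIMSEQ_Suc[OF lim_const_over_n[of l]] by simp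
      moreover have "isCont ?n 0"
        unfolding normal_density_def by (intro continuous_intros) auto
      ultimately show "(\<lambda>k. ?n (l / real (Suc k))) \<longlonglongrightarrow> ?n 0"
        by (rule isCont_tendsto_compose[rotated])
    qed
    show "AE l in lborel. norm (?n (l / real (Suc k)) * f l) \<le> ?n 0 * \<bar>f l\<bar>" for k
      by (intro always_eventually) (auto simp: abs_mult std_normal_density_le_at_0 intro!: mult_right_mono)
  qed measurable
  then have "(LINT l|lborel. ?n 0 * f l) \<le> sqrt (2 * pi) * Q 0"
    by (rule LIMSEQ_le_const2) (use step in auto)
  then show ?thesis
    by (simp add: std_normal_density_def divide_simps) (simp add: mult_ac)
qed

text \<open>
  The sine part of the addition formula integrates to zero because \<open>r\<close> is even.
\<close>

lemma shifted_cos_integral: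
  fixes r :: "real \<Rightarrow> real"
  assumes r: "integrable lborel r" and even: "\<And>x. r (- x) = r x"
  shows "has_bochner_integral lborel (\<lambda>v. r (d + v) * cos (l * v))
     (cos (l * d) * (LINT x|lborel. r x * cos (l * x)))"
proof -
  have [measurable]: "r \<in> borel_measurable borel" using r by auto
  have ic: "integrable lborel (\<lambda>x. r x * cos (l * x))"
    by (rule Bochner_Integration.integrable_bound[OF r])
      (auto simp: abs_mult intro!: always_eventually mult_left_le)
  have isn: "integrable lborel (\<lambda>x. r x * sin (l * x))"
    by (rule Bochner_Integration.integrable_bound[OF r])
      (auto simp: abs_mult intro!: always_eventually mult_left_le)
  have "(LINT x|lborel. r x * sin (l * x)) = (LINT x|lborel. - (r x * sin (l * x)))"
    using lborel_integral_real_affine[of "-1" "\<lambda>x. r x * sin (l * x)" 0] by (simp add: even)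
  then have odd: "(LINT x|lborel. r x * sin (l * x)) = 0" by simp
  have "has_bochner_integral lborel
     (\<lambda>x. cos (l * d) * (r x * cos (l * x)) + sin (l * d) * (r x * sin (l * x)))
     (cos (l * d) * (LINT x|lborel. r x * cos (l * x)) + sin (l * d) * (LINT x|lborel. r x * sin (l * x)))"
    by (intro has_bochner_integral_add has_bochner_integral_mult_right has_bochner_integral_integrable ic isn)
  moreover have "cos (l * d) * (r x * cos (l * x)) + sin (l * d) * (r x * sin (l * x)) =
      r x * cos (l * (x - d))" for x
    by (simp add: right_diff_distrib cos_diff) (simp add: algebra_simps)
  ultimately have "has_bochner_integral lborel (\<lambda>x. r x * cos (l * (x - d)))
     (cos (l * d) * (LINT x|lborel. r x * cos (l * x)))"
    by (simp add: odd)
  then show ?thesis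
    by (subst (asm) lborel_has_bochner_integral_real_affine_iff[of 1 _ _ d]) auto
qed

lemma double_sum_cos:
  fixes b y :: "'i \<Rightarrow> real"
  shows "(\<Sum>j\<in>J. \<Sum>k\<in>J. b j * b k * cos (l * (y j - y k))) =
     (\<Sum>j\<in>J. b j * cos (y j * l))\<^sup>2 + (\<Sum>j\<in>J. b j * sin (y j * l))\<^sup>2"
  unfolding power2_eq_square sum_product sum.distrib[symmetric]
proof (intro sum.cong refl)
  fix j k
  have "l * (y j - y k) = y j * l - y k * l" by (simp add: algebra_simps)
  then show "b j * b k * cos (l * (y j - y k)) =
      b j * cos (y j * l) * (b k * cos (y k * l)) + b j * sin (y j * l) * (b k * sin (y k * l))"
    by (simp only: cos_diff) (simp add: algebra_simps)
qed

text \<open>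
  The hypothesis that shifts do not increase the form is the only trace of positive definiteness.
  Translating all \<open>x j\<close> by \<open>x j\<^sub>0\<close> changes neither the form nor the modulus of its trigonometric
  sum, whose real part \<open>B\<close> then has the distinguished frequency \<open>0\<close>; the imaginary part is dropped.
\<close>

lemma quadratic_form_lower_bound:
  fixes r :: "real \<Rightarrow> real" and H c :: real
  assumes H: "0 < H" "H < 1" and c: "0 < c"
    and r: "integrable lborel r" and even: "\<And>x. r (- x) = r x"
    and spec: "\<And>l. c * (1 + \<bar>l\<bar>) powr (- (1 + 2 * H)) \<le> (LINT x|lborel. r x * cos (l * x))"
  obtains \<kappa> where "0 < \<kappa>"
    "\<And>(J :: 'i set) x b j\<^sub>0 \<epsilon>. finite J \<Longrightarrow> j\<^sub>0 \<in> J \<Longrightarrow> 0 < \<epsilon> \<Longrightarrow> \<epsilon> \<le> 1 \<Longrightarrow>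
        (\<And>j. j \<in> J - {j\<^sub>0} \<Longrightarrow> \<epsilon> \<le> \<bar>x j - x j\<^sub>0\<bar>) \<Longrightarrow>
        (\<And>v. (\<Sum>j\<in>J. \<Sum>k\<in>J. b j * b k * r (x j - x k + v)) \<le> (\<Sum>j\<in>J. \<Sum>k\<in>J. b j * b k * r (x j - x k))) \<Longrightarrow>
        \<kappa> * (b j\<^sub>0)\<^sup>2 * \<epsilon> powr (2 * H) \<le> (\<Sum>j\<in>J. \<Sum>k\<in>J. b j * b k * r (x j - x k))"
proof -
  obtain \<kappa> where \<kappa>: "0 < \<kappa>" and energy:
    "\<And>(J :: 'i set) u b j\<^sub>0 \<epsilon>. finite J \<Longrightarrow> j\<^sub>0 \<in> J \<Longrightarrow> u j\<^sub>0 = 0 \<Longrightarrow> 0 < \<epsilon> \<Longrightarrow> \<epsilon> \<le> 1 \<Longrightarrow>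
        (\<And>j. j \<in> J - {j\<^sub>0} \<Longrightarrow> \<epsilon> \<le> \<bar>u j\<bar>) \<Longrightarrow>
        integrable lborel (\<lambda>l. (\<Sum>j\<in>J. b j * cos (u j * l))\<^sup>2 * (1 + \<bar>l\<bar>) powr (- (1 + 2 * H))) \<and>
        \<kappa> * (b j\<^sub>0)\<^sup>2 * \<epsilon> powr (2 * H) \<le>
          (LINT l|lborel. (\<Sum>j\<in>J. b j * cos (u j * l))\<^sup>2 * (1 + \<bar>l\<bar>) powr (- (1 + 2 * H)))"
    using weighted_energy_lower_bound[OF H, where 'i = 'i] by blast
  show thesis
  proof (rule that[of "c * \<kappa> / (2 * pi)"])
    show "0 < c * \<kappa> / (2 * pi)" using c \<kappa> by simp
    fix J :: "'i set" and x b j\<^sub>0 and \<epsilon> :: real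
    assume J: "finite J" "j\<^sub>0 \<in> J" and eps: "0 < \<epsilon>" "\<epsilon> \<le> 1"
      and sep: "\<And>j. j \<in> J - {j\<^sub>0} \<Longrightarrow> \<epsilon> \<le> \<bar>x j - x j\<^sub>0\<bar>"
      and max: "\<And>v. (\<Sum>j\<in>J. \<Sum>k\<in>J. b j * b k * r (x j - x k + v)) \<le> (\<Sum>j\<in>J. \<Sum>k\<in>J. b j * b k * r (x j - x k))"
    define u where "u j = x j - x j\<^sub>0" for j
    define B where "B l = (\<Sum>j\<in>J. b j * cos (u j * l))" for l
    define w where "w l = (1 + \<bar>l\<bar>) powr (- (1 + 2 * H))" for l :: real
    define Q where "Q v = (\<Sum>j\<in>J. \<Sum>k\<in>J. b j * b k * r (x j - x k + v))" for v
    define rh where "rh l = (LINT x|lborel. r x * cos (l * x))" for l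
    have en: "integrable lborel (\<lambda>l. (B l)\<^sup>2 * w l)"
      "\<kappa> * (b j\<^sub>0)\<^sup>2 * \<epsilon> powr (2 * H) \<le> (LINT l|lborel. (B l)\<^sup>2 * w l)"
      using energy[of J j\<^sub>0 u \<epsilon> b] J eps sep unfolding B_def w_def u_def by simp_all
    have "integrable lborel (\<lambda>v. r (d + v))" for d
      using lborel_integrable_real_affine[OF r, of 1 d] by simp
    then have Q: "integrable lborel Q"
      unfolding Q_def[abs_def] by (intro Bochner_Integration.integrable_sum integrable_mult_right)
    have "(LINT l|lborel. c * ((B l)\<^sup>2 * w l)) \<le> 2 * pi * Q 0"
    proof (rule integral_cos_transform_le_value_at_max[OF Q])
      show "Q v \<le> Q 0" for v using max by (simp add: Q_def)
      show "integrable lborel (\<lambda>l. c * ((B l)\<^sup>2 * w l))" using en(1) by simp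
      fix l
      have "has_bochner_integral lborel (\<lambda>v. \<Sum>j\<in>J. \<Sum>k\<in>J. b j * b k * (r (x j - x k + v) * cos (l * v)))
         (\<Sum>j\<in>J. \<Sum>k\<in>J. b j * b k * (cos (l * (x j - x k)) * rh l))"
        unfolding rh_def
        by (intro has_bochner_integral_sum has_bochner_integral_mult_right shifted_cos_integral r even)
      moreover have "(\<Sum>j\<in>J. \<Sum>k\<in>J. b j * b k * (r (x j - x k + v) * cos (l * v))) = Q v * cos (l * v)" for v
        unfolding Q_def sum_distrib_right by (simp add: mult_ac)
      ultimately have "(LINT v|lborel. Q v * cos (l * v)) =
          (\<Sum>j\<in>J. \<Sum>k\<in>J. b j * b k * (cos (l * (x j - x k)) * rh l))"
        by (simp add: has_bochner_integral_iff)
      also have "\<dots> = (\<Sum>j\<in>J. \<Sum>k\<in>J. b j * b k * cos (l * (u j - u k))) * rh l"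
        unfolding sum_distrib_right by (simp add: u_def mult_ac)
      also have "\<dots> = ((B l)\<^sup>2 + (\<Sum>j\<in>J. b j * sin (u j * l))\<^sup>2) * rh l"
        unfolding double_sum_cos B_def ..
      finally have eq: "(LINT v|lborel. Q v * cos (l * v)) = ((B l)\<^sup>2 + (\<Sum>j\<in>J. b j * sin (u j * l))\<^sup>2) * rh l" .
      have rh: "c * w l \<le> rh l" using spec unfolding w_def rh_def .
      have "0 \<le> c * w l" using c by (simp add: w_def)
      with rh have "(B l)\<^sup>2 * (c * w l) \<le> ((B l)\<^sup>2 + (\<Sum>j\<in>J. b j * sin (u j * l))\<^sup>2) * rh l"
        by (intro mult_mono) auto
      then show "c * ((B l)\<^sup>2 * w l) \<le> (LINT v|lborel. Q v * cos (l * v))"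
        unfolding eq by (simp add: mult_ac)
    qed
    moreover have "c * (\<kappa> * (b j\<^sub>0)\<^sup>2 * \<epsilon> powr (2 * H)) \<le> c * (LINT l|lborel. (B l)\<^sup>2 * w l)"
      using en(2) c by (intro mult_left_mono) auto
    ultimately have "c * (\<kappa> * (b j\<^sub>0)\<^sup>2 * \<epsilon> powr (2 * H)) \<le> 2 * pi * Q 0" by simp
    then have "c * \<kappa> / (2 * pi) * (b j\<^sub>0)\<^sup>2 * \<epsilon> powr (2 * H) \<le> Q 0"
      by (simp add: divide_simps mult_ac)
    then show "c * \<kappa> / (2 * pi) * (b j\<^sub>0)\<^sup>2 * \<epsilon> powr (2 * H) \<le> (\<Sum>j\<in>J. \<Sum>k\<in>J. b j * b k * r (x j - x k))"
      by (simp add: Q_def)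
  qed
qed

section \<open>Self-similar Gaussian processes in logarithmic time\<close>

text \<open>
  The covariance at two times is an integral with respect to the law of the process, so equality of
  laws transfers it.
\<close>

lemma (in prob_space) self_similar_covariance:
  assumes G: "centered_gaussian_process M {0..} Z" and S: "self_similar M H Z"
    and a: "0 < a" and st: "0 \<le> s" "0 \<le> t"
  shows "inner2 (Z (a * s)) (Z (a * t)) = a powr (2 * H) * inner2 (Z s) (Z t)"
proof -
  have Zm: "Z u \<in> borel_measurable M" if "0 \<le> u" for u
    using square_integrable_measurable[OF centered_gaussian_process_square_integrable[OF G]] that by simp
  let ?P = "\<Pi>\<^sub>M t\<in>{0::real..}. (borel :: real measure)"
  have law: "(\<integral>f. f s * f t \<partial>process_law M {0..} X) = (\<integral>\<omega>. X s \<omega> * X t \<omega> \<partial>M)"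
    if [measurable]: "\<And>u. 0 \<le> u \<Longrightarrow> X u \<in> borel_measurable M" for X :: "real \<Rightarrow> 'a \<Rightarrow> real"
  proof -
    have "(\<lambda>\<omega>. \<lambda>t\<in>{0..}. X t \<omega>) \<in> measurable M ?P"
      by (intro measurable_restrict) auto
    moreover have "(\<lambda>f. f s * f t) \<in> borel_measurable ?P"
      using st by (intro borel_measurable_times measurable_component_singleton) auto
    ultimately show ?thesis
      using st unfolding process_law_def by (subst integral_distr) auto
  qed
  have "(\<integral>\<omega>. Z (a * s) \<omega> * Z (a * t) \<omega> \<partial>M) = (\<integral>\<omega>. (a powr H * Z s \<omega>) * (a powr H * Z t \<omega>) \<partial>M)"
    using S a law[of "\<lambda>t. Z (a * t)"] law[of "\<lambda>t \<omega>. a powr H * Z t \<omega>"] Zm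
    unfolding self_similar_def by simp
  also have "\<dots> = (\<integral>\<omega>. a powr (2 * H) * (Z s \<omega> * Z t \<omega>) \<partial>M)"
  proof -
    have "a powr (2 * H) = a powr H * a powr H" by (simp flip: powr_add)
    then show ?thesis by (simp add: mult_ac)
  qed
  finally show ?thesis by (simp add: inner2_def)
qed

lemma (in prob_space) covariance_eq_lamperti_cov:
  assumes G: "centered_gaussian_process M {0..} Z" and S: "self_similar M H Z"
  shows "inner2 (Z (exp x)) (Z (exp y)) = exp (H * (x + y)) * lamperti_cov M H Z (x - y)"
proof -
  have "inner2 (Z (exp x)) (Z (exp y)) = inner2 (Z (exp y * exp (x - y))) (Z (exp y * 1))"
    by (simp flip: exp_add)
  also have "\<dots> = exp y powr (2 * H) * inner2 (Z (exp (x - y))) (Z 1)"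
    by (rule self_similar_covariance[OF G S]) auto
  also have "inner2 (Z (exp (x - y))) (Z 1) = exp (H * (x - y)) * lamperti_cov M H Z (x - y)"
    by (simp add: lamperti_cov_def inner2_def mult.commute mult.left_commute flip: exp_add mult.assoc)
  also have "exp y powr (2 * H) * (exp (H * (x - y)) * lamperti_cov M H Z (x - y)) =
      exp (H * (x + y)) * lamperti_cov M H Z (x - y)"
    by (simp add: powr_def algebra_simps flip: exp_add mult.assoc)
  finally show ?thesis .
qed

lemma (in prob_space) lamperti_cov_even:
  assumes "centered_gaussian_process M {0..} Z" "self_similar M H Z"
  shows "lamperti_cov M H Z (- u) = lamperti_cov M H Z u"
  using covariance_eq_lamperti_cov[OF assms, of 0 u] covariance_eq_lamperti_cov[OF assms, of u 0]
    inner2_commute[of "Z (exp 0)" "Z (exp u)"]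
  by simp

text \<open>
  With \<open>Y y = exp (- H * y) * Z (exp y)\<close> stationary, let \<open>A\<close> and \<open>C\<close> be the linear combination with
  coefficients \<open>b\<close> at the points \<open>x j + v\<close> and \<open>x j\<close>. They have the same second moment, so
  \<open>0 \<le> E ((A - C)\<^sup>2)\<close> says that \<open>E (A * C)\<close> is at most this second moment.
\<close>

lemma (in prob_space) lamperti_cov_shift_le:
  fixes b x :: "'i \<Rightarrow> real"
  assumes G: "centered_gaussian_process M {0..} Z" and S: "self_similar M H Z"
  defines "r \<equiv> lamperti_cov M H Z"
  shows "(\<Sum>j\<in>J. \<Sum>k\<in>J. b j * b k * r (x j - x k + v)) \<le> (\<Sum>j\<in>J. \<Sum>k\<in>J. b j * b k * r (x j - x k))"
proof -
  define Y where "Y y \<omega> = exp (- H * y) * Z (exp y) \<omega>" for y \<omega>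
  have Y: "Y y \<in> square_integrable" for y
    unfolding Y_def[abs_def]
    by (intro square_integrable_cmult centered_gaussian_process_square_integrable[OF G]) simp
  have cov: "inner2 (Y y) (Y z) = r (y - z)" for y z
  proof -
    have "inner2 (Y y) (Y z) = exp (- H * y) * (exp (- H * z) * inner2 (Z (exp y)) (Z (exp z)))"
      unfolding Y_def[abs_def] inner2_cmult_left
      by (subst inner2_commute, subst inner2_cmult_left, subst inner2_commute) simp
    moreover have "exp (- H * y) * (exp (- H * z) * exp (H * (y + z))) = 1"
      unfolding exp_add[symmetric] by (simp add: algebra_simps)
    ultimately show ?thesis
      unfolding covariance_eq_lamperti_cov[OF G S] r_def
      by (simp only: mult.assoc[symmetric] mult_1_left)
  qed
  let ?A = "\<lambda>\<omega>. \<Sum>j\<in>J. b j * Y (x j + v) \<omega>" and ?C = "\<lambda>\<omega>. \<Sum>j\<in>J. b j * Y (x j) \<omega>"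
  have A: "?A \<in> square_integrable" and C: "?C \<in> square_integrable"
    by (intro square_integrable_sum Y)+
  have AC: "(\<lambda>\<omega>. ?A \<omega> - ?C \<omega>) \<in> square_integrable"
    by (rule square_integrable_diff[OF A C])
  have "0 \<le> inner2 (\<lambda>\<omega>. ?A \<omega> - ?C \<omega>) (\<lambda>\<omega>. ?A \<omega> - ?C \<omega>)"
    unfolding inner2_def by (rule integral_nonneg_AE) simp
  also have "\<dots> = inner2 ?A (\<lambda>\<omega>. ?A \<omega> - ?C \<omega>) - inner2 ?C (\<lambda>\<omega>. ?A \<omega> - ?C \<omega>)"
    by (rule inner2_diff_left[OF A C AC])
  also have "inner2 ?A (\<lambda>\<omega>. ?A \<omega> - ?C \<omega>) = inner2 ?A ?A - inner2 ?A ?C"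
    by (subst (1 3) inner2_commute) (rule inner2_diff_left[OF A C A])
  also have "inner2 ?C (\<lambda>\<omega>. ?A \<omega> - ?C \<omega>) = inner2 ?A ?C - inner2 ?C ?C"
    by (subst inner2_commute) (rule inner2_diff_left[OF A C C])
  finally have "2 * inner2 ?A ?C \<le> inner2 ?A ?A + inner2 ?C ?C" by simp
  then show ?thesis
    by (simp add: inner2_sum_sum Y cov algebra_simps)
qed

lemma generated_by_cong:
  assumes "\<And>i. i \<in> I \<Longrightarrow> X i = Y i"
  shows "generated_by M I X = generated_by M I Y"
proof -
  have "(\<lambda>\<omega>. \<lambda>i\<in>I. X i \<omega>) = (\<lambda>\<omega>. \<lambda>i\<in>I. Y i \<omega>)" using assms by (auto simp: fun_eq_iff)
  then show ?thesis by (simp add: generated_by_def)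
qed

section \<open>Local nondeterminism\<close>

theorem theorem5p1:
  fixes M :: "'a measure" and Z :: "real \<Rightarrow> 'a \<Rightarrow> real" and H :: real and r :: "real \<Rightarrow> real"
  assumes "prob_space M"
    and "0 < H" and "H < 1"
    and "centered_gaussian_process M {0..} Z"
    and "self_similar M H Z"
    and r: "r = lamperti_cov M H Z"
    and "\<forall>t\<ge>0. r t \<ge> 0"
    and "antimono_on {0..} r"
    and "integrable lborel r"
    and "\<exists>c>0. \<forall>l::real. (LBINT t:{0..}. r t * cos (t * l)) \<ge> c / (\<bar>l\<bar> + 1) powr (1 + 2 * H)"
  shows "\<exists>\<kappa>>0. \<forall>(m::nat) (s::nat \<Rightarrow> real) (t::real).
           m \<ge> 1 \<and> s 0 = 0 \<and> s 0 < s 1 \<and> (\<forall>j\<in>{1..<m}. s j \<le> s (Suc j)) \<and> s m < t \<longrightarrow>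
           (AE \<omega> in M.
              cond_variance M (generated_by M {1..m} (\<lambda>j. Z (s j))) (Z t) \<omega>
                \<ge> \<kappa> * Min ((\<lambda>j. \<bar>t - s j\<bar> powr (2 * H)) ` {1..m}))"
proof -
  interpret prob_space M by fact
  note H = \<open>0 < H\<close> \<open>H < 1\<close>
  note G = \<open>centered_gaussian_process M {0..} Z\<close> and S = \<open>self_similar M H Z\<close>
  note ri = \<open>integrable lborel r\<close>
  have even: "r (- x) = r x" for x
    unfolding r by (rule lamperti_cov_even[OF G S])
  obtain c where c: "0 < c"
    and half: "\<And>l. c / (\<bar>l\<bar> + 1) powr (1 + 2 * H) \<le> (LBINT t:{0..}. r t * cos (t * l))"
    using assms(10) by blast
  have spec: "2 * c * (1 + \<bar>l\<bar>) powr (- (1 + 2 * H)) \<le> (LINT x|lborel. r x * cos (l * x))" for l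
  proof -
    have "integrable lborel (\<lambda>x. r x * cos (l * x))"
      using shifted_cos_integral[OF ri even, of 0 l] by (simp add: has_bochner_integral_iff)
    then have "integrable lborel (\<lambda>x. indicator {0..} x *\<^sub>R (r x * cos (l * x)))"
      by (intro integrable_mult_indicator) auto
    from has_bochner_integral_even_function[OF has_bochner_integral_integrable[OF this]]
    have "(LINT x|lborel. r x * cos (l * x)) = 2 * (LBINT t:{0..}. r t * cos (l * t))"
      by (simp add: has_bochner_integral_iff even set_lebesgue_integral_def)
    moreover have "2 * c * (1 + \<bar>l\<bar>) powr (- (1 + 2 * H)) = 2 * (c / (\<bar>l\<bar> + 1) powr (1 + 2 * H))"
      unfolding powr_minus_divide by (simp add: add.commute)
    ultimately show ?thesis using half[of l] by (simp add: mult.commute[of l])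
  qed
  have "0 < 2 * c" using c by simp
  from quadratic_form_lower_bound[OF H this ri even spec, where 'i = nat] obtain \<kappa> where \<kappa>: "0 < \<kappa>"
    and bound: "\<And>(J :: nat set) x b j\<^sub>0 \<epsilon>. finite J \<Longrightarrow> j\<^sub>0 \<in> J \<Longrightarrow> 0 < \<epsilon> \<Longrightarrow> \<epsilon> \<le> 1 \<Longrightarrow>
        (\<And>j. j \<in> J - {j\<^sub>0} \<Longrightarrow> \<epsilon> \<le> \<bar>x j - x j\<^sub>0\<bar>) \<Longrightarrow>
        (\<And>v. (\<Sum>j\<in>J. \<Sum>k\<in>J. b j * b k * r (x j - x k + v)) \<le> (\<Sum>j\<in>J. \<Sum>k\<in>J. b j * b k * r (x j - x k))) \<Longrightarrow>
        \<kappa> * (b j\<^sub>0)\<^sup>2 * \<epsilon> powr (2 * H) \<le> (\<Sum>j\<in>J. \<Sum>k\<in>J. b j * b k * r (x j - x k))"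
    by blast
  show ?thesis
  proof (intro exI[of _ \<kappa>] conjI \<kappa> allI impI)
    fix m :: nat and s :: "nat \<Rightarrow> real" and t :: real
    assume *: "m \<ge> 1 \<and> s 0 = 0 \<and> s 0 < s 1 \<and> (\<forall>j\<in>{1..<m}. s j \<le> s (Suc j)) \<and> s m < t"
    have s_le: "s j \<le> s m" if "j \<in> {1..m}" for j
    proof -
      have "j \<le> m" using that by simp
      then show ?thesis
        using that
      proof (induction rule: inc_induct)
        case (step n)
        then show ?case using * by force
      qed simp
    qed
    have s_pos: "0 < s j" if "j \<in> {1..m}" for j
    proof -
      have "1 \<le> j" using that by simp
      then show ?thesis
        using that
      proof (induction rule: dec_induct)
        case (step n)
        then have "s n \<le> s (Suc n)" using * by simp
        with step show ?case by simp
      qed (use * in simp)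
    qed
    have sm: "0 < s m" "s m < t" using s_pos[of m] * by auto
    \<comment> \<open>The slot \<open>0\<close>, occupied by the dummy time \<open>s 0 = 0\<close>, is reused for the predicted time \<open>t\<close>.\<close>
    define T where "T j = (if j = 0 then t else s j)" for j
    define x where "x j = ln (T j)" for j
    have Tpos: "0 < T j" if "j \<in> {0..m}" for j
      using s_pos[of j] sm that by (auto simp: T_def)
    have ex: "exp (x j) = T j" if "j \<in> {0..m}" for j
      using Tpos[OF that] by (simp add: x_def)
    have I: "{0..m} = insert 0 {1..m}" by auto
    have "centered_gaussian_process M {0..m} (\<lambda>j. Z (T j))"
      using Tpos by (intro centered_gaussian_process_reindex[OF G]) (auto intro: less_imp_le)
    then obtain a where a: "AE \<omega> in M. cond_variance M (generated_by M {1..m} (\<lambda>j. Z (T j))) (Z (T 0)) \<omega> =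
       inner2 (\<lambda>\<omega>. Z (T 0) \<omega> - (\<Sum>i\<in>{1..m}. a i * Z (T i) \<omega>)) (\<lambda>\<omega>. Z (T 0) \<omega> - (\<Sum>i\<in>{1..m}. a i * Z (T i) \<omega>))"
      unfolding I by (rule cond_variance_gaussian) auto
    have gen: "generated_by M {1..m} (\<lambda>j. Z (T j)) = generated_by M {1..m} (\<lambda>j. Z (s j))"
      by (rule generated_by_cong) (auto simp: T_def)
    define d where "d j = (if j = 0 then 1 else - a j)" for j
    define b where "b j = d j * exp (H * x j)" for j
    have res: "Z (T 0) \<omega> - (\<Sum>i\<in>{1..m}. a i * Z (T i) \<omega>) = (\<Sum>j\<in>{0..m}. d j * Z (T j) \<omega>)" for \<omega>
    proof -
      have "(\<Sum>j\<in>{1..m}. d j * Z (T j) \<omega>) = (\<Sum>j\<in>{1..m}. - (a j * Z (T j) \<omega>))"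
        by (intro sum.cong) (auto simp: d_def)
      then show ?thesis unfolding I by (simp add: d_def sum_negf)
    qed
    have "inner2 (\<lambda>\<omega>. Z (T 0) \<omega> - (\<Sum>i\<in>{1..m}. a i * Z (T i) \<omega>)) (\<lambda>\<omega>. Z (T 0) \<omega> - (\<Sum>i\<in>{1..m}. a i * Z (T i) \<omega>)) =
       (\<Sum>j\<in>{0..m}. \<Sum>k\<in>{0..m}. d j * d k * inner2 (Z (T j)) (Z (T k)))"
      unfolding res using Tpos
      by (intro inner2_sum_sum centered_gaussian_process_square_integrable[OF G]) (auto intro: less_imp_le)
    also have "\<dots> = (\<Sum>j\<in>{0..m}. \<Sum>k\<in>{0..m}. b j * b k * r (x j - x k))"
    proof (intro sum.cong refl)
      fix j k assume "j \<in> {0..m}" "k \<in> {0..m}"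
      then have "inner2 (Z (T j)) (Z (T k)) = exp (H * (x j + x k)) * r (x j - x k)"
        using covariance_eq_lamperti_cov[OF G S, of "x j" "x k"] ex by (simp add: r)
      then show "d j * d k * inner2 (Z (T j)) (Z (T k)) = b j * b k * r (x j - x k)"
        by (simp add: b_def distrib_left exp_add)
    qed
    finally have form: "inner2 (\<lambda>\<omega>. Z (T 0) \<omega> - (\<Sum>i\<in>{1..m}. a i * Z (T i) \<omega>)) (\<lambda>\<omega>. Z (T 0) \<omega> - (\<Sum>i\<in>{1..m}. a i * Z (T i) \<omega>)) =
       (\<Sum>j\<in>{0..m}. \<Sum>k\<in>{0..m}. b j * b k * r (x j - x k))" .
    \<comment> \<open>The latest observation is the nearest one; in logarithmic time it is at distance
      \<open>- ln (s m / t) \<ge> 1 - s m / t\<close> from the predicted time.\<close>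
    define \<epsilon> where "\<epsilon> = (t - s m) / t"
    have eps: "0 < \<epsilon>" "\<epsilon> \<le> 1" using sm by (auto simp: \<epsilon>_def)
    have sep: "\<epsilon> \<le> \<bar>x j - x 0\<bar>" if "j \<in> {0..m} - {0}" for j
    proof -
      have j: "j \<in> {1..m}" "j \<noteq> 0" using that by auto
      have "x j - x 0 = ln (s j / t)"
        using s_pos[OF j(1)] sm j by (simp add: x_def T_def ln_div)
      also have "\<dots> \<le> s j / t - 1"
        using s_pos[OF j(1)] sm by (intro ln_le_minus_one) simp
      also have "\<dots> \<le> s m / t - 1"
        using s_le[OF j(1)] sm by (simp add: divide_right_mono)
      also have "\<dots> = - \<epsilon>" using sm by (simp add: \<epsilon>_def field_simps)
      finally show ?thesis by linarith
    qed
    have "\<kappa> * (b 0)\<^sup>2 * \<epsilon> powr (2 * H) \<le> (\<Sum>j\<in>{0..m}. \<Sum>k\<in>{0..m}. b j * b k * r (x j - x k))"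
      by (rule bound) (use eps sep lamperti_cov_shift_le[OF G S] in \<open>auto simp: r\<close>)
    moreover have "\<kappa> * (b 0)\<^sup>2 * \<epsilon> powr (2 * H) = \<kappa> * \<bar>t - s m\<bar> powr (2 * H)"
    proof -
      have "(b 0)\<^sup>2 = t powr (2 * H)"
        using sm by (simp add: b_def d_def x_def T_def powr_def power2_eq_square flip: exp_add)
      then show ?thesis using sm by (simp add: \<epsilon>_def powr_divide)
    qed
    moreover have "Min ((\<lambda>j. \<bar>t - s j\<bar> powr (2 * H)) ` {1..m}) \<le> \<bar>t - s m\<bar> powr (2 * H)"
      using * by (intro Min_le image_eqI[of _ _ m]) auto
    then have "\<kappa> * Min ((\<lambda>j. \<bar>t - s j\<bar> powr (2 * H)) ` {1..m}) \<le> \<kappa> * \<bar>t - s m\<bar> powr (2 * H)"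
      using \<kappa> by (intro mult_left_mono) auto
    ultimately show "AE \<omega> in M. cond_variance M (generated_by M {1..m} (\<lambda>j. Z (s j))) (Z t) \<omega>
        \<ge> \<kappa> * Min ((\<lambda>j. \<bar>t - s j\<bar> powr (2 * H)) ` {1..m})"
      using a unfolding gen form by (auto elim!: eventually_mono simp: T_def)
  qed
qed

end
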